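(* Among all strongly continuous semigroups on $C[0,1]$ generated by one-dimensional Laplace operators, there is exactly one that preserves the moments of order $0$ and $1$. It is the semigroup generated by the operator $A$ given by $$D(A)=\{f\in C^2[0,1]:F_0(f'')=F_1(f'')=0\},\qquad Af=f'',$$ that is, the semigroup $(S(t))_{t\ge0}$ given by $S(0)=\mathrm{Id}$ and the Weierstrass formula $$S(t)f=\frac1{\sqrt{\pi t}}\int_0^\infty e^{-\tau^2/4t}\,C_{\rm mp}(\tau)f\,d\tau,\qquad t>0,\ f\in C[0,1].$$
   Context: $C[0,1]$ is the Banach space of continuous real-valued functions on $[0,1]$ with the supremum norm; $\mathbb N=\{0,1,2,\dots\}$. The moment functionals are $F_if=\int_0^1x^if(x)\,dx$. A semigroup $(T(t))_{t\ge0}$ on $C[0,1]$ preserves the moment of order $i$ if $F_iT(t)f=F_if$ for all $f\in C[0,1]$, $t\ge0$. A one-dimensional Laplace operator (a realization of the Laplace operator) in $C[0,1]$ is an operator $A_{\rm p}$ with domain $D(A_{\rm p})\subset C^2[0,1]$ and $A_{\rm p}f=f''$ for $f\in D(A_{\rm p})$. For $f\in C^2[0,1]$, the conditions $F_0(f'')=F_1(f'')=0$ are equivalent to $f'(0)=f'(1)=f(1)-f(0)$. $(C_{\rm mp}(t))_{t\in\mathbb R}$ is the strongly continuous cosine family on $C[0,1]$ given by $C_{\rm mp}(t)f(x)=\frac12(\tilde f(x+t)+\tilde f(x-t))$, $x\in[0,1]$, where $\tilde f$ is the integral extension of $f$, defined as follows. Given $f\in C[0,1]$, define $g_n,h_n\in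 C[0,1]$, $n\in\mathbb N$, recursively by $g_0(x)=f(x)$, $h_0(x)=f(1-x)$, and $h_{n+1}=g_n-\psi_n$, $g_{n+1}=h_n+\psi_n$, where $d_n=h_n-g_n$ and $\psi_n(x)=-e^{2x}\int_0^1d_n(y)\,dy+2\int_0^xe^{2(x-y)}d_n(y)\,dy$. Then $\tilde f:\mathbb R\to\mathbb R$ is the (well-defined, continuous) function determined by $\tilde f(x+n)=g_n(x)$ and $\tilde f(1-x-n)=h_n(x)$ for $x\in[0,1]$, $n\in\mathbb N$. *)

theory Defs
  imports "HOL-Analysis.Analysis"
begin

section \<open>The Banach space of continuous functions on the unit interval\<close>

typedef unit_interval = "{0..1::real}"
  morphisms of_unit to_unit
  by (rule exI[of _ 0]) simp

instantiation unit_interval :: metric_space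
begin

definition dist_unit_interval :: "unit_interval \<Rightarrow> unit_interval \<Rightarrow> real"
  where "dist x y = dist (of_unit x) (of_unit y)"

definition uniformity_unit_interval :: "(unit_interval \<times> unit_interval) filter"
  where "uniformity_unit_interval = (INF e\<in>{0 <..}. principal {(x, y). dist x y < e})"

definition open_unit_interval :: "unit_interval set \<Rightarrow> bool"
  where "open_unit_interval U = (\<forall>x\<in>U. \<forall>\<^sub>F (x', y) in uniformity. x' = x \<longrightarrow> y \<in> U)"

instance
proof
  fix x y z :: unit_interval
  show "dist x y = 0 \<longleftrightarrow> x = y"
    by (simp add: dist_unit_interval_def of_unit_inject)
  show "dist x y \<le> dist x z + dist y z"
    unfolding dist_unit_interval_def by (rule dist_triangle2)
qed (simp_all only: uniformity_unit_interval_def open_unit_interval_def)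

end

lemma continuous_on_of_unit [continuous_intros]: "continuous_on S of_unit"
  unfolding continuous_on_iff dist_unit_interval_def by blast

lemma continuous_on_to_unit: "continuous_on {0..1} to_unit"
  unfolding continuous_on_iff dist_unit_interval_def by (auto simp: to_unit_inverse)

lemma compact_UNIV_unit_interval: "compact (UNIV :: unit_interval set)"
proof -
  have "to_unit ` {0..1} = UNIV"
    using of_unit of_unit_inverse by (metis UNIV_eq_I imageI)
  then show ?thesis
    using compact_continuous_image[OF continuous_on_to_unit] by auto
qed

text \<open>
  As the unit interval is compact, every continuous function on it is bounded, and the library's
  type of bounded continuous functions is \<open>C[0,1]\<close> with the supremum norm.
\<close>

instance bcontfun :: (metric_space, banach) banach ..

type_synonym C01 = "unit_interval \<Rightarrow>\<^sub>C real"

text \<open>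
  An element of \<open>C[0,1]\<close> as a function of a real variable. Outside the unit interval it takes the
  value at the nearest endpoint; no definition below depends on these values.
\<close>

definition fun_of :: "C01 \<Rightarrow> real \<Rightarrow> real"
  where "fun_of f x = apply_bcontfun f (to_unit (max 0 (min 1 x)))"

text \<open>The restriction to the unit interval of a function that is continuous there.\<close>

definition C01_of :: "(real \<Rightarrow> real) \<Rightarrow> C01"
  where "C01_of \<phi> = Bcontfun (\<lambda>x. \<phi> (of_unit x))"

lemma continuous_on_fun_of: "continuous_on S (fun_of f)"
proof -
  have "continuous_on S (\<lambda>x. to_unit (max 0 (min 1 x)))"
    by (rule continuous_on_compose2[OF continuous_on_to_unit]) (auto intro!: continuous_intros)
  then show ?thesis
    unfolding fun_of_def
    by (rule continuous_on_compose2[OF continuous_on_apply_bcontfun[of UNIV f], simplified])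
qed

lemma fun_of_C01_of:
  assumes "continuous_on {0..1} \<phi>" and "x \<in> {0..1}"
  shows "fun_of (C01_of \<phi>) x = \<phi> x"
proof -
  have cont: "continuous_on UNIV (\<lambda>x. \<phi> (of_unit x))"
    by (rule continuous_on_compose2[OF assms(1) continuous_on_of_unit]) (use of_unit in auto)
  have "bounded (range (\<lambda>x. \<phi> (of_unit x)))"
    by (intro compact_imp_bounded compact_continuous_image cont compact_UNIV_unit_interval)
  with cont have "(\<lambda>x. \<phi> (of_unit x)) \<in> bcontfun"
    by (simp add: bcontfun_def)
  with assms(2) show ?thesis
    by (simp add: fun_of_def C01_of_def Bcontfun_inverse to_unit_inverse)
qed

lemma C01_eqI:
  assumes "\<And>x. x \<in> {0..1} \<Longrightarrow> fun_of f x = fun_of g x"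
  shows "f = g"
proof (rule bcontfun_eqI)
  fix u
  have "of_unit u \<in> {0..1}" by (rule of_unit)
  with assms[of "of_unit u"] show "apply_bcontfun f u = apply_bcontfun g u"
    by (simp add: fun_of_def of_unit_inverse)
qed

section \<open>Semigroups, generators, moments, Laplace operators\<close>

text \<open>The values of \<open>T\<close> at negative times are irrelevant.\<close>

definition strongly_continuous_semigroup :: "(real \<Rightarrow> 'a::banach \<Rightarrow>\<^sub>L 'a) \<Rightarrow> bool"
  where "strongly_continuous_semigroup T \<longleftrightarrow>
    T 0 = id_blinfun \<and>
    (\<forall>s\<ge>0. \<forall>t\<ge>0. T (s + t) = T s o\<^sub>L T t) \<and>
    (\<forall>f. continuous_on {0..} (\<lambda>t. T t f))"

text \<open>Unbounded operators are represented by their graphs.\<close>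

definition generator :: "(real \<Rightarrow> 'a::banach \<Rightarrow>\<^sub>L 'a) \<Rightarrow> ('a \<times> 'a) set"
  where "generator T = {(f, g). ((\<lambda>t. (T t f - f) /\<^sub>R t) \<longlongrightarrow> g) (at_right 0)}"

definition moment :: "nat \<Rightarrow> C01 \<Rightarrow> real"
  where "moment i f = integral {0..1} (\<lambda>x. x ^ i * fun_of f x)"

definition preserves_moment :: "(real \<Rightarrow> C01 \<Rightarrow>\<^sub>L C01) \<Rightarrow> nat \<Rightarrow> bool"
  where "preserves_moment T i \<longleftrightarrow> (\<forall>f. \<forall>t\<ge>0. moment i (T t f) = moment i f)"

definition has_deriv_C01 :: "C01 \<Rightarrow> C01 \<Rightarrow> bool"
  where "has_deriv_C01 f g \<longleftrightarrow>
    (\<forall>x\<in>{0..1}. (fun_of f has_real_derivative fun_of g x) (at x within {0..1}))"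

text \<open>The graph of \<open>f \<mapsto> f''\<close> with domain \<open>C\<^sup>2[0,1]\<close>.\<close>

definition second_derivative :: "(C01 \<times> C01) set"
  where "second_derivative = {(f, g). \<exists>f'. has_deriv_C01 f f' \<and> has_deriv_C01 f' g}"

definition laplace_operator :: "(C01 \<times> C01) set \<Rightarrow> bool"
  where "laplace_operator L \<longleftrightarrow> subspace L \<and> L \<subseteq> second_derivative"

definition moment_laplace :: "(C01 \<times> C01) set"
  where "moment_laplace = {(f, g) \<in> second_derivative. moment 0 g = 0 \<and> moment 1 g = 0}"

section \<open>The integral extension and the moments-preserving cosine family\<close>

definition ext_psi :: "(real \<Rightarrow> real) \<Rightarrow> real \<Rightarrow> real"
  where "ext_psi d x =
    - exp (2 * x) * integral {0..1} d + 2 * integral {0..x} (\<lambda>y. exp (2 * (x - y)) * d y)"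

fun ext_g :: "C01 \<Rightarrow> nat \<Rightarrow> real \<Rightarrow> real" and ext_h :: "C01 \<Rightarrow> nat \<Rightarrow> real \<Rightarrow> real"
  where
    "ext_g f 0 x = fun_of f x"
  | "ext_h f 0 x = fun_of f (1 - x)"
  | "ext_g f (Suc n) x = ext_h f n x + ext_psi (\<lambda>y. ext_h f n y - ext_g f n y) x"
  | "ext_h f (Suc n) x = ext_g f n x - ext_psi (\<lambda>y. ext_h f n y - ext_g f n y) x"

definition is_integral_extension :: "C01 \<Rightarrow> (real \<Rightarrow> real) \<Rightarrow> bool"
  where "is_integral_extension f F \<longleftrightarrow>
    (\<forall>n. \<forall>x\<in>{0..1}. F (x + real n) = ext_g f n x \<and> F (1 - x - real n) = ext_h f n x)"

definition integral_extension :: "C01 \<Rightarrow> real \<Rightarrow> real"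
  where "integral_extension f = (THE F. is_integral_extension f F)"

definition cosine_mp :: "real \<Rightarrow> C01 \<Rightarrow> C01"
  where "cosine_mp t f =
    C01_of (\<lambda>x. (integral_extension f (x + t) + integral_extension f (x - t)) / 2)"

subsection \<open>Well-definedness\<close>

lemma ext_psi_has_derivative:
  assumes "continuous_on {0..1} d" and "x \<in> {0..1}"
  shows "(ext_psi d has_real_derivative 2 * ext_psi d x + 2 * d x) (at x within {0..1})"
proof -
  define J where "J x = integral {0..x} (\<lambda>y. exp (- 2 * y) * d y)" for x
  have eq: "ext_psi d x = exp (2 * x) * (2 * J x - integral {0..1} d)" for x
  proof -
    have "(\<lambda>y. exp (2 * (x - y)) * d y) = (\<lambda>y. exp (2 * x) * (exp (- 2 * y) * d y))"
    proof
      fix y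
      have "exp (2 * (x - y)) = exp (2 * x) * exp (- 2 * y)"
        unfolding exp_add[symmetric] by simp
      then show "exp (2 * (x - y)) * d y = exp (2 * x) * (exp (- 2 * y) * d y)"
        by (simp only: mult.assoc)
    qed
    then have "integral {0..x} (\<lambda>y. exp (2 * (x - y)) * d y) = exp (2 * x) * J x"
      unfolding J_def by (simp only: integral_mult_right)
    then show ?thesis
      unfolding ext_psi_def by (simp only:) (simp add: algebra_simps)
  qed
  have J: "(J has_real_derivative exp (- 2 * x) * d x) (at x within {0..1})"
    unfolding J_def
    by (rule integral_has_real_derivative) (use assms in \<open>auto intro!: continuous_intros\<close>)
  have "((\<lambda>x. exp (2 * x) * (2 * J x - integral {0..1} d)) has_real_derivative
      2 * exp (2 * x) * (2 * J x - integral {0..1} d)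
        + 2 * (exp (- 2 * x) * d x) * exp (2 * x)) (at x within {0..1})"
    by (auto intro!: derivative_eq_intros J)
  moreover have "2 * (exp (- 2 * x) * d x) * exp (2 * x) = 2 * d x"
    by (simp add: exp_minus)
  moreover have "ext_psi d = (\<lambda>x. exp (2 * x) * (2 * J x - integral {0..1} d))"
    using eq by (rule ext)
  ultimately show ?thesis
    by (simp only: mult.assoc)
qed

lemma continuous_on_ext_psi: "continuous_on {0..1} d \<Longrightarrow> continuous_on {0..1} (ext_psi d)"
  by (meson DERIV_continuous_on ext_psi_has_derivative)

lemma continuous_on_ext: "continuous_on {0..1} (ext_g f n) \<and> continuous_on {0..1} (ext_h f n)"
proof (induction n)
  case 0
  have "continuous_on {0..1} (\<lambda>x. fun_of f (1 - x))"
    by (rule continuous_on_compose2[OF continuous_on_fun_of[of UNIV]])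
       (auto intro!: continuous_intros)
  then show ?case
    using continuous_on_fun_of[of "{0..1}" f] by simp
next
  case (Suc n)
  then have "continuous_on {0..1} (ext_psi (\<lambda>y. ext_h f n y - ext_g f n y))"
    by (intro continuous_on_ext_psi continuous_intros) auto
  with Suc show ?case
    by (auto intro!: continuous_intros)
qed

lemma ext_psi_0: "ext_psi d 0 = - integral {0..1} d"
  by (simp add: ext_psi_def)

lemma ext_psi_1:
  assumes "continuous_on {0..1} d"
  shows "ext_psi d 1 = integral {0..1} d + 2 * integral {0..1} (ext_psi d)"
proof -
  have "((\<lambda>x. 2 * ext_psi d x + 2 * d x) has_integral (ext_psi d 1 - ext_psi d 0)) {0..1}"
    by (rule fundamental_theorem_of_calculus)
       (use ext_psi_has_derivative[OF assms] in
         \<open>auto simp: has_real_derivative_iff_has_vector_derivative\<close>)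
  moreover have "((\<lambda>x. 2 * ext_psi d x + 2 * d x) has_integral
      (2 * integral {0..1} (ext_psi d) + 2 * integral {0..1} d)) {0..1}"
    by (intro has_integral_add has_integral_mult_right integrable_integral
        integrable_continuous_real continuous_on_ext_psi assms)
  ultimately have "ext_psi d 1 - ext_psi d 0
      = 2 * integral {0..1} (ext_psi d) + 2 * integral {0..1} d"
    by (rule has_integral_unique)
  then show ?thesis by (simp add: ext_psi_0)
qed

lemma ext_ends:
  defines "D \<equiv> \<lambda>f n. integral {0..1} (\<lambda>y. ext_h f n y - ext_g f n y)"
  shows "ext_g f n 1 = ext_h f n 0 - D f n \<and> ext_h f n 1 = ext_g f n 0 + D f n"
proof (induction n)
  case 0
  have "integral {0..1} (\<lambda>y. fun_of f (1 - y)) = integral {0..1} (fun_of f)"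
    using Henstock_Kurzweil_Integration.integral_reflect_real[of 0 "- 1" "\<lambda>y. fun_of f (1 + y)"]
      integral_shift[where a = "- 1" and b = 0 and c = 1 and f = "fun_of f", OF continuous_on_fun_of]
    by (simp add: o_def add.commute)
  moreover have "(\<lambda>y. fun_of f (1 - y)) integrable_on {0..1}"
    using conjunct2[OF continuous_on_ext[of f 0]] by (intro integrable_continuous_real) simp
  moreover have "fun_of f integrable_on {0..1}"
    by (intro integrable_continuous_real continuous_on_fun_of)
  ultimately show ?case by (simp add: D_def integral_diff)
next
  case (Suc n)
  define d where "d = (\<lambda>y. ext_h f n y - ext_g f n y)"
  have cd: "continuous_on {0..1} d"
    unfolding d_def using continuous_on_ext[of f n] by (auto intro!: continuous_intros)
  have "D f (Suc n) = integral {0..1} (\<lambda>y. - d y - 2 * ext_psi d y)"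
    unfolding D_def ext_g.simps ext_h.simps d_def[symmetric] by (simp add: d_def algebra_simps)
  also have "\<dots> = - integral {0..1} d - 2 * integral {0..1} (ext_psi d)"
    by (rule integral_unique)
       (intro has_integral_diff has_integral_neg has_integral_mult_right integrable_integral
        integrable_continuous_real continuous_on_ext_psi cd)
  also have "\<dots> = - ext_psi d 1"
    by (simp add: ext_psi_1[OF cd])
  finally have "D f (Suc n) = - ext_psi d 1" .
  moreover have "D f n = integral {0..1} d"
    by (simp add: D_def d_def)
  ultimately show ?case
    using Suc by (simp add: d_def[symmetric] ext_psi_0)
qed

lemma ext_g_glue: "ext_g f (Suc n) 0 = ext_g f n 1"
  and ext_h_glue: "ext_h f (Suc n) 0 = ext_h f n 1"
  using ext_ends[of f n] by (simp_all add: ext_psi_0)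

lemma is_integral_extension_unique:
  assumes "is_integral_extension f F" and "is_integral_extension f G"
  shows "F = G"
proof
  fix y
  show "F y = G y"
  proof (cases "y \<ge> 0")
    case True
    define n where "n = nat \<lfloor>y\<rfloor>"
    from True have "y - real n \<in> {0..1}" unfolding n_def by auto linarith
    with assms have "F (y - real n + real n) = G (y - real n + real n)"
      unfolding is_integral_extension_def by (metis (no_types))
    then show ?thesis by simp
  next
    case False
    define n where "n = nat \<lfloor>1 - y\<rfloor>"
    from False have "1 - y - real n \<in> {0..1}" unfolding n_def by auto linarith
    with assms have "F (1 - (1 - y - real n) - real n) = G (1 - (1 - y - real n) - real n)"
      unfolding is_integral_extension_def by (metis (no_types))
    then show ?thesis by simp
  qed
qed

lemma is_integral_extension_exists:
  "\<exists>F. is_integral_extension f F \<and> continuous_on UNIV F"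
proof -
  define \<phi> where "\<phi> k y = (if k \<ge> 0 then ext_g f (nat k) (y - real_of_int k)
      else ext_h f (nat (- k)) (1 - y + real_of_int k))" for k :: int and y :: real
  define T where "T k = {real_of_int k .. real_of_int k + 1}" for k
  have cont: "continuous_on (T k) (\<phi> k)" for k
  proof (cases "k \<ge> 0")
    case True
    have "continuous_on (T k) (\<lambda>y. ext_g f (nat k) (y - real_of_int k))"
      by (rule continuous_on_compose2[OF conjunct1[OF continuous_on_ext]])
         (auto simp: T_def intro!: continuous_intros)
    with True show ?thesis unfolding \<phi>_def by simp
  next
    case False
    have "continuous_on (T k) (\<lambda>y. ext_h f (nat (- k)) (1 - y + real_of_int k))"
      by (rule continuous_on_compose2[OF conjunct2[OF continuous_on_ext]])
         (auto simp: T_def intro!: continuous_intros)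
    with False show ?thesis unfolding \<phi>_def by simp
  qed
  have step: "\<phi> k (real_of_int k + 1) = \<phi> (k + 1) (real_of_int k + 1)" for k
  proof -
    consider (pos) "k \<ge> 0" | (zero) "k = - 1" | (neg) "k < - 1" by linarith
    then show ?thesis
    proof cases
      case pos
      then show ?thesis using ext_g_glue[of f "nat k"]
        by (simp add: \<phi>_def nat_add_distrib)
    next
      case zero
      then show ?thesis using ext_h_glue[of f 0] by (simp add: \<phi>_def)
    next
      case neg
      then have "nat (- k) = Suc (nat (- (k + 1)))" by simp
      with neg ext_h_glue[of f "nat (- (k + 1))"] show ?thesis
        by (simp add: \<phi>_def del: ext_h.simps)
    qed
  qed
  have overlap_less: "\<phi> j y = \<phi> k y" if "j < k" "y \<in> T j" "y \<in> T k" for j k y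
  proof -
    from that have "real_of_int j + 1 \<ge> real_of_int k" unfolding T_def by simp
    with that(1) have "k = j + 1" by linarith
    with that have "y = real_of_int j + 1" unfolding T_def by simp
    with \<open>k = j + 1\<close> show ?thesis using step by simp
  qed
  have overlap: "\<phi> j y = \<phi> k y" if "y \<in> T j" "y \<in> T k" for j k y
    using that
  proof (cases j k rule: linorder_cases)
    case less
    with that show ?thesis by (metis overlap_less)
  next
    case greater
    with that show ?thesis by (metis overlap_less)
  qed simp
  define F where "F y = \<phi> \<lfloor>y\<rfloor> y" for y
  have F: "F y = \<phi> k y" if "y \<in> T k" for y k
    unfolding F_def by (rule overlap) (use that in \<open>auto simp: T_def\<close>)
  have "continuous (at y) F" for y
  proof -
    define k where "k = \<lfloor>y - 1/2\<rfloor>"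
    have "continuous_on (T k \<union> T (k + 1)) F"
    proof (rule continuous_on_closed_Un)
      show "continuous_on (T k) F" "continuous_on (T (k + 1)) F"
        using cont F by (metis (no_types, lifting) continuous_on_cong)+
    qed (auto simp: T_def)
    moreover have "T k \<union> T (k + 1) = {real_of_int k .. real_of_int k + 2}"
      by (auto simp: T_def)
    moreover have "y \<in> interior {real_of_int k .. real_of_int k + 2}"
      unfolding k_def by simp linarith
    ultimately show ?thesis by (metis continuous_on_interior)
  qed
  moreover have "is_integral_extension f F"
    unfolding is_integral_extension_def
  proof (intro allI ballI conjI)
    fix n :: nat and x :: real assume x: "x \<in> {0..1}"
    show "F (x + real n) = ext_g f n x"
      using x by (subst F[of _ "int n"]) (auto simp: T_def \<phi>_def)
    have "F (1 - x - real n) = \<phi> (- int n) (1 - x - real n)"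
      using x by (intro F) (auto simp: T_def)
    also have "\<dots> = ext_h f n x"
      by (cases "n = 0") (simp_all add: \<phi>_def)
    finally show "F (1 - x - real n) = ext_h f n x" .
  qed
  ultimately show ?thesis by (auto intro: continuous_at_imp_continuous_on)
qed

lemma integral_extension:
  "is_integral_extension f (integral_extension f)"
  "continuous_on UNIV (integral_extension f)"
proof -
  obtain F where F: "is_integral_extension f F" "continuous_on UNIV F"
    using is_integral_extension_exists by blast
  then have "integral_extension f = F"
    unfolding integral_extension_def by (blast intro: is_integral_extension_unique)
  with F show "is_integral_extension f (integral_extension f)"
    "continuous_on UNIV (integral_extension f)" by simp_all
qed

lemma fun_of_cosine_mp:
  assumes "x \<in> {0..1}"
  shows "fun_of (cosine_mp t f) x =
    (integral_extension f (x + t) + integral_extension f (x - t)) / 2"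
  unfolding cosine_mp_def
proof (rule fun_of_C01_of[OF _ assms])
  show "continuous_on {0..1}
      (\<lambda>x. (integral_extension f (x + t) + integral_extension f (x - t)) / 2)"
    by (intro continuous_intros continuous_on_compose2[OF integral_extension(2)]) auto
qed

end

theory Submission
  imports Defs "HOL-Probability.Probability"
begin

text \<open>
  A continuous \<open>F\<close> on the real line has the same moments of order 0 and 1 on the unit interval after
  every symmetric translation \<open>x \<mapsto> (F (x + t) + F (x - t)) / 2\<close> iff
  \<open>F (1 + t) - F (1 - t) = F t - F (- t) = \<integral>\<^sub>0\<^sup>1 (F (x + t) - F (x - t)) dx\<close> for all \<open>t\<close>.
  Differentiating the last expression for \<open>\<psi> t = F (1 + t) - F (1 - t)\<close> gives the differential
  equation \<open>\<psi>' = 2 \<psi> + 2 d\<close> behind the recursion for \<open>g\<^sub>n\<close> and \<open>h\<^sub>n\<close>, so these \<open>F\<close> are exactly the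
  integral extensions. The conditions survive convolution with a symmetric measure; hence
  convolution of the extension with the Gaussian kernel is a semigroup on \<open>C[0,1]\<close>, and it is the one
  given by the Weierstrass formula. If \<open>f\<close> lies in the domain of \<open>A\<close>, its extension is twice
  differentiable with second derivative the extension of \<open>f''\<close>, and a Taylor expansion shows that the
  generator extends \<open>A\<close>.

  Conversely, if \<open>(f, g)\<close> is in the generator, then \<open>g\<close> has vanishing moments, so \<open>g = A u\<close> for some
  \<open>u\<close>, and \<open>f - u\<close> is fixed by the semigroup; fixed points turn out to be in the kernel of \<open>A\<close>.
  A moment-preserving semigroup generated by a Laplace operator has its generator contained in \<open>A\<close>,
  and a generator contained in another generator determines the same semigroup.
\<close>

section \<open>Functions satisfying the moment conditions\<close>

text \<open>The two conditions arise by differentiating in \<open>t\<close> the moments of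
  \<open>x \<mapsto> F (x + t) + F (x - t)\<close>: order 0 gives the first, order 1 gives the
  second after integration by parts. Their use is that they are linear and determine
  \<open>F\<close> from its values on the unit interval. The recursion is thus unfolded only to
  establish the characterisation and a growth bound; later, a convolution or a double antiderivative
  is recognised as an extension by checking the conditions. The obstacle is growth: each step of the
  recursion may multiply the sup norm by a constant, so extensions are only exponentially bounded.
  Hence every measure is required to have all exponential moments, and every limit under an integral
  needs an exponential majorant. Convolutions are scalar integrals evaluated at points; their
  convergence in the norm of C[0,1] is obtained from scalar integrals of norms of translates. The
  generator is found without resolvents: every function with vanishing moments of order 0 and 1 is
  in the range of the Laplacian restricted to the domain of \<open>A\<close>, so only fixed points
  remain to be examined.\<close>

lemma ex_antiderivative:
  fixes F :: "real \<Rightarrow> real"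
  assumes "continuous_on UNIV F"
  obtains G where "\<And>x. (G has_real_derivative F x) (at x)"
proof -
  have "\<exists>G. \<forall>x. -\<infinity> < ereal x \<longrightarrow> ereal x < \<infinity> \<longrightarrow> (G has_vector_derivative F x) (at x)"
    by (rule einterval_antiderivative) (use assms in \<open>auto simp: continuous_on_eq_continuous_at\<close>)
  then show ?thesis
    using that by (auto simp: has_real_derivative_iff_has_vector_derivative)
qed

lemma integral_eq_antiderivative:
  fixes F G :: "real \<Rightarrow> real"
  assumes "\<And>x. (G has_real_derivative F x) (at x)" "a \<le> b"
  shows "integral {a..b} F = G b - G a"
proof -
  have "(F has_integral (G b - G a)) {a..b}"
    by (rule fundamental_theorem_of_calculus)
       (use assms in \<open>auto simp flip: has_real_derivative_iff_has_vector_derivative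
          intro: DERIV_subset\<close>)
  then show ?thesis by (rule integral_unique)
qed

lemma continuous_on_UNIV_compose:
  fixes F :: "real \<Rightarrow> 'a::topological_space"
  assumes "continuous_on UNIV F" "continuous_on S h"
  shows "continuous_on S (\<lambda>x. F (h x))"
  by (rule continuous_on_compose2[OF assms]) auto

definition shift_integral :: "(real \<Rightarrow> real) \<Rightarrow> real \<Rightarrow> real"
  where "shift_integral F t = integral {0..1} (\<lambda>x. F (x + t) - F (x - t))"

definition moment_extension :: "(real \<Rightarrow> real) \<Rightarrow> bool"
  where "moment_extension F \<longleftrightarrow> continuous_on UNIV F \<and>
    (\<forall>t. F (1 + t) - F (1 - t) = F t - F (- t)) \<and>
    (\<forall>t. F (1 + t) - F (1 - t) = shift_integral F t)"

lemma shift_integral_antiderivative: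
  assumes "\<And>x. (G has_real_derivative F x) (at x)"
  shows "shift_integral F t = (G (1 + t) - G t) - (G (1 - t) - G (- t))"
proof -
  have "((\<lambda>x. G (x + t) - G (x - t)) has_real_derivative F (x + t) - F (x - t)) (at x)" for x
    by (auto intro!: derivative_eq_intros DERIV_chain'[OF _ assms])
  from integral_eq_antiderivative[OF this, of 0 1] show ?thesis
    by (simp add: shift_integral_def)
qed

lemma has_real_derivative_shift_integral:
  assumes "continuous_on UNIV F"
  shows "(shift_integral F has_real_derivative F (1 + t) - F t + F (1 - t) - F (- t)) (at t)"
proof -
  obtain G where G: "\<And>x. (G has_real_derivative F x) (at x)"
    using ex_antiderivative[OF assms] by blast
  have "((\<lambda>t. (G (1 + t) - G t) - (G (1 - t) - G (- t))) has_real_derivative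
      F (1 + t) - F t + F (1 - t) - F (- t)) (at t)"
    by (auto intro!: derivative_eq_intros DERIV_chain'[OF _ G])
  then show ?thesis
    by (simp add: shift_integral_antiderivative[OF G, abs_def])
qed

text \<open>The integrating factor \<open>exp (- c * x)\<close> turns the equation into a vanishing
  derivative. With \<open>c = 2\<close> this gives uniqueness for the equation solved by
  \<open>ext_psi\<close>.\<close>

lemma linear_ode_zero:
  fixes u :: "real \<Rightarrow> real"
  assumes "\<And>x. x \<in> {0..1} \<Longrightarrow> (u has_real_derivative c * u x) (at x within {0..1})"
    and "u 0 = 0" "x \<in> {0..1}"
  shows "u x = 0"
proof -
  have "((\<lambda>x. exp (- c * x) * u x) has_real_derivative 0) (at x within {0..1})"
    if "x \<in> {0..1}" for x
    by (rule derivative_eq_intros assms(1) that refl | simp)+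
  then obtain k where k: "exp (- c * x) * u x = k" if "x \<in> {0..1}" for x
    using has_field_derivative_zero_constant[of "{0..1::real}" "\<lambda>x. exp (- c * x) * u x"] by auto
  show ?thesis using k[of x] k[of 0] assms(2,3) by auto
qed

text \<open>Induction over unit intervals. Once \<open>F\<close> is known at \<open>x + n\<close>
  and \<open>1 - x - n\<close>, the inhomogeneity \<open>d\<close> is known, so the linear equation
  for \<open>\<Psi>\<close> has \<open>ext_psi d\<close> as its only solution with the right initial
  value; \<open>\<Psi>\<close> then yields \<open>F\<close> on the next interval on either
  side.\<close>

lemma moment_extension_is_integral_extension:
  assumes F: "moment_extension F" and f: "\<And>x. x \<in> {0..1} \<Longrightarrow> F x = fun_of f x"
  shows "is_integral_extension f F"
proof -
  have "\<forall>x\<in>{0..1}. F (x + real n) = ext_g f n x \<and> F (1 - x - real n) = ext_h f n x" for n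
  proof (induction n)
    case 0
    then show ?case using f by auto
  next
    case (Suc n)
    define d where "d = (\<lambda>y. ext_h f n y - ext_g f n y)"
    define \<Psi> where "\<Psi> t = F (1 + t) - F (1 - t)" for t
    have cont: "continuous_on UNIV F" and odd: "\<Psi> t = F t - F (- t)"
      and \<Psi>: "\<Psi> = shift_integral F" for t
      using F by (auto simp: moment_extension_def \<Psi>_def)
    have cd: "continuous_on {0..1} d"
      unfolding d_def using continuous_on_ext[of f n] by (auto intro!: continuous_intros)
    have d: "d x = F (1 - (x + real n)) - F (x + real n)" if "x \<in> {0..1}" for x
      using Suc that by (auto simp: d_def algebra_simps)
    have "((\<lambda>x. \<Psi> (x + real n)) has_real_derivative
        2 * \<Psi> (x + real n) + 2 * d x) (at x within {0..1})" if "x \<in> {0..1}" for x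
    proof -
      have "((\<lambda>x. \<Psi> (x + real n)) has_real_derivative
        (F (1 + (x + real n)) - F (x + real n) + F (1 - (x + real n)) - F (- (x + real n))) * (1 + 0))
          (at x within {0..1})"
        unfolding \<Psi>
        by (rule has_field_derivative_at_within[OF DERIV_chain'[OF
              DERIV_add[OF DERIV_ident DERIV_const] has_real_derivative_shift_integral[OF cont]]])
      then show ?thesis
        by (rule DERIV_cong) (use odd[of "x + real n"] d[OF that] in \<open>simp add: \<Psi>_def\<close>)
    qed
    note D = this
    \<comment> \<open>The initial value uses only stage \<open>n\<close>: the point
      \<open>1 + n\<close> is the right end of the interval carrying \<open>ext_g f n\<close>, and
      \<open>ext_ends\<close> evaluates the resulting difference.\<close>
    have zero: "\<Psi> (0 + real n) = ext_psi d 0"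
    proof -
      have "F (1 + real n) = ext_g f n 1" "F (1 - real n) = ext_h f n 0"
        using Suc[rule_format, of 1] Suc[rule_format, of 0] by auto
      then show ?thesis
        using ext_ends[of f n] by (simp add: \<Psi>_def ext_psi_0 d_def)
    qed
    have eq: "\<Psi> (x + real n) = ext_psi d x" if "x \<in> {0..1}" for x
    proof -
      have "((\<lambda>x. \<Psi> (x + real n) - ext_psi d x) has_real_derivative
          2 * (\<Psi> (x + real n) - ext_psi d x)) (at x within {0..1})" if "x \<in> {0..1}" for x
        using DERIV_diff[OF D[OF that] ext_psi_has_derivative[OF cd that]] by (simp add: algebra_simps)
      from linear_ode_zero[OF this _ that] zero show ?thesis by simp
    qed
    show ?case
    proof (intro ballI conjI)
      fix x :: real assume x: "x \<in> {0..1}"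
      have g: "F (x + real n) = ext_g f n x" and h: "F (1 - x - real n) = ext_h f n x"
        using Suc x by auto
      \<comment> \<open>The definition of \<open>\<Psi>\<close> extends \<open>F\<close> to the
        right, and the oddness condition extends it to the left.\<close>
      have "F (1 + (x + real n)) = \<Psi> (x + real n) + F (1 - (x + real n))"
        by (simp add: \<Psi>_def)
      also have "\<dots> = ext_psi d x + ext_h f n x"
        using eq[OF x] h by (simp add: algebra_simps)
      finally show "F (x + real (Suc n)) = ext_g f (Suc n) x"
        by (simp add: d_def algebra_simps)
      have "F (- (x + real n)) = F (x + real n) - \<Psi> (x + real n)"
        by (simp add: odd)
      also have "\<dots> = ext_g f n x - ext_psi d x"
        using eq[OF x] g by simp
      finally show "F (1 - x - real (Suc n)) = ext_h f (Suc n) x"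
        by (simp add: d_def algebra_simps)
    qed
  qed
  then show ?thesis by (simp add: is_integral_extension_def)
qed

lemma integral_extension_unique:
  assumes "moment_extension F" "\<And>x. x \<in> {0..1} \<Longrightarrow> F x = fun_of f x"
  shows "integral_extension f = F"
  using moment_extension_is_integral_extension[OF assms] integral_extension(1)
    is_integral_extension_unique by blast

lemma integral_extension_simps:
  assumes "x \<in> {0..1}"
  shows "integral_extension f (x + real n) = ext_g f n x"
    and "integral_extension f (1 - x - real n) = ext_h f n x"
  using integral_extension(1)[of f] assms unfolding is_integral_extension_def by blast+

lemma integral_extension_unit:
  assumes "x \<in> {0..1}"
  shows "integral_extension f x = fun_of f x"
  using integral_extension_simps(1)[OF assms, of f 0] by simp

lemma unit_decomposition:
  fixes t :: real
  assumes "t \<ge> 0"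
  obtains n x where "t = x + real n" "x \<in> {0..1}" "real n \<le> t"
proof (rule that)
  show "t = (t - real (nat \<lfloor>t\<rfloor>)) + real (nat \<lfloor>t\<rfloor>)" by simp
qed (use assms in auto, linarith)

text \<open>The first condition is visible in the recursion:
  \<open>ext_g f (Suc n) - ext_h f n\<close> and \<open>ext_g f n - ext_h f (Suc n)\<close> are the
  same \<open>ext_psi\<close>. For the second, both sides have equal derivatives on each unit
  interval and agree at 0. Negative \<open>t\<close> follow because all sides are odd in
  \<open>t\<close>.\<close>

lemma moment_extension_integral_extension: "moment_extension (integral_extension f)"
proof -
  define F where "F = integral_extension f"
  define \<Psi> where "\<Psi> t = F (1 + t) - F (1 - t)" for t
  have cont: "continuous_on UNIV F" unfolding F_def by (rule integral_extension)
  have F: "F (x + real n) = ext_g f n x" "F (1 + (x + real n)) = ext_g f (Suc n) x"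
    "F (1 - (x + real n)) = ext_h f n x" "F (- (x + real n)) = ext_h f (Suc n) x"
    if "x \<in> {0..1}" for n x
    using integral_extension_simps[OF that, of f n] integral_extension_simps[OF that, of f "Suc n"]
    by (simp_all add: F_def algebra_simps del: ext_g.simps ext_h.simps)
  have odd0: "\<Psi> t = F t - F (- t)" if "t \<ge> 0" for t
  proof -
    obtain n x where t: "t = x + real n" "x \<in> {0..1}" using unit_decomposition[OF \<open>t \<ge> 0\<close>] by metis
    show ?thesis unfolding \<Psi>_def t(1) F[OF t(2)] by simp
  qed
  have odd: "\<Psi> t = F t - F (- t)" for t
    using odd0[of t] odd0[of "- t"] by (cases "t \<ge> 0") (auto simp: \<Psi>_def)
  \<comment> \<open>The defect of the second condition is constant on \<open>[n, n + 1]\<close>, so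
    it can be carried from one integer to the next.\<close>
  have step: "\<Psi> (x + real n) - shift_integral F (x + real n) = \<Psi> (real n) - shift_integral F (real n)"
    if x: "x \<in> {0..1}" for n x
  proof -
    define d where "d = (\<lambda>y. ext_h f n y - ext_g f n y)"
    have cd: "continuous_on {0..1} d"
      unfolding d_def using continuous_on_ext[of f n] by (auto intro!: continuous_intros)
    have \<Psi>: "\<Psi> (x + real n) = ext_psi d x" if "x \<in> {0..1}" for x
      unfolding \<Psi>_def F[OF that] by (simp add: d_def)
    have "((\<lambda>x. ext_psi d x - shift_integral F (x + real n)) has_real_derivative 0) (at x within {0..1})"
      if "x \<in> {0..1}" for x
    proof -
      have "((\<lambda>x. shift_integral F (x + real n)) has_real_derivative
        (F (1 + (x + real n)) - F (x + real n) + F (1 - (x + real n)) - F (- (x + real n))) * (1 + 0))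
          (at x within {0..1})"
        by (rule has_field_derivative_at_within[OF DERIV_chain'[OF
              DERIV_add[OF DERIV_ident DERIV_const] has_real_derivative_shift_integral[OF cont]]])
      from DERIV_diff[OF ext_psi_has_derivative[OF cd that] this] show ?thesis
        by (rule DERIV_cong) (simp only: F[OF that], simp add: d_def)
    qed
    then obtain k where "ext_psi d x - shift_integral F (x + real n) = k" if "x \<in> {0..1}" for x
      using has_field_derivative_zero_constant[of "{0..1::real}"
          "\<lambda>x. ext_psi d x - shift_integral F (x + real n)"] by auto
    then show ?thesis using \<Psi>[OF x] \<Psi>[of 0] x by force
  qed
  have "\<Psi> (real n) = shift_integral F (real n)" for n
  proof (induction n)
    case 0
    show ?case by (simp add: \<Psi>_def shift_integral_def)
  next
    case (Suc n)
    then show ?case using step[of 1 n] by (simp add: add.commute)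
  qed
  with step have int0: "\<Psi> t = shift_integral F t" if "t \<ge> 0" for t
    using unit_decomposition[OF that] by (metis right_minus_eq)
  have "shift_integral F (- t) = - shift_integral F t" for t
    unfolding shift_integral_def
    by (simp only: diff_minus_eq_add add_uminus_conv_diff flip: integral_neg) simp
  then have "\<Psi> t = shift_integral F t" for t
    using int0[of t] int0[of "- t"] by (cases "t \<ge> 0") (auto simp: \<Psi>_def)
  then show ?thesis
    using cont odd unfolding moment_extension_def F_def[symmetric] \<Psi>_def by blast
qed

section \<open>Exponential growth of the extension, uniform in the norm of the function\<close>

lemma abs_fun_of_le: "\<bar>fun_of f x\<bar> \<le> norm f"
  using norm_bounded[of f] by (simp add: fun_of_def)

text \<open>In the constant 3, one unit comes from the full integral of \<open>d\<close> and two
  from the weighted partial integral, each with a weight of at most \<open>exp 2\<close>.\<close>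

lemma abs_ext_psi_le:
  assumes "continuous_on {0..1} d" "\<And>x. x \<in> {0..1} \<Longrightarrow> \<bar>d x\<bar> \<le> B" "x \<in> {0..1}"
  shows "\<bar>ext_psi d x\<bar> \<le> 3 * exp 2 * B"
proof -
  have "B \<ge> 0" using assms(2)[of 0] by auto
  have 1: "\<bar>integral {0..1} d\<bar> \<le> B"
    using integral_bound[of 0 1 d B] assms by auto
  have "norm (integral {0..x} (\<lambda>y. exp (2 * (x - y)) * d y)) \<le> exp 2 * B * (x - 0)"
  proof (rule integral_bound)
    show "continuous_on {0..x} (\<lambda>y. exp (2 * (x - y)) * d y)"
      using assms by (intro continuous_intros continuous_on_subset[OF assms(1)]) auto
    show "norm (exp (2 * (x - y)) * d y) \<le> exp 2 * B" if "y \<in> {0..x}" for y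
      unfolding norm_mult using that assms by (intro mult_mono) auto
  qed (use assms in auto)
  also have "\<dots> \<le> exp 2 * B * 1"
    using assms \<open>B \<ge> 0\<close> by (intro mult_left_mono) auto
  finally have 2: "\<bar>integral {0..x} (\<lambda>y. exp (2 * (x - y)) * d y)\<bar> \<le> exp 2 * B" by simp
  have "\<bar>exp (2 * x) * integral {0..1} d\<bar> \<le> exp 2 * B"
    unfolding abs_mult using 1 assms by (intro mult_mono) auto
  with 2 show ?thesis unfolding ext_psi_def by linarith
qed

text \<open>If stage \<open>n\<close> is bounded by \<open>B\<close>, then \<open>d\<close> is
  bounded by \<open>2 * B\<close>, \<open>ext_psi d\<close> by \<open>6 * exp 2 * B\<close>, and
  stage \<open>Suc n\<close> by \<open>(1 + 6 * exp 2) * B\<close>. The logarithm makes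
  \<open>n\<close> steps cost \<open>exp (growth * n)\<close>.\<close>

definition growth :: real where "growth = ln (1 + 6 * exp 2)"

lemma growth_pos: "growth > 0"
  unfolding growth_def by (rule ln_gt_zero) simp

lemma abs_ext_le:
  assumes "x \<in> {0..1}"
  shows "\<bar>ext_g f n x\<bar> \<le> exp (growth * n) * norm f \<and> \<bar>ext_h f n x\<bar> \<le> exp (growth * n) * norm f"
  using assms
proof (induction n arbitrary: x)
  case 0
  then show ?case by (simp add: abs_fun_of_le)
next
  case (Suc n)
  define d where "d = (\<lambda>y. ext_h f n y - ext_g f n y)"
  define B where "B = exp (growth * n) * norm f"
  have cd: "continuous_on {0..1} d"
    unfolding d_def using continuous_on_ext[of f n] by (auto intro!: continuous_intros)
  have "\<bar>d y\<bar> \<le> 2 * B" if "y \<in> {0..1}" for y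
    using Suc.IH[OF that] by (auto simp: d_def B_def)
  from abs_ext_psi_le[OF cd this Suc.prems] have "\<bar>ext_psi d x\<bar> \<le> 6 * exp 2 * B" by simp
  moreover have "exp growth = 1 + 6 * exp 2" by (simp add: growth_def add_pos_pos)
  then have "exp (growth * Suc n) * norm f = B + 6 * exp 2 * B"
    by (simp add: B_def algebra_simps exp_add)
  ultimately show ?case
    using Suc.IH[OF Suc.prems] unfolding ext_g.simps ext_h.simps d_def[symmetric] B_def[symmetric]
    by linarith
qed

text \<open>The leading factor \<open>exp growth\<close> pays for the index of the interval
  containing \<open>y\<close>, which can be as large as \<open>1 + \<bar>y\<bar>\<close> on the
  negative side. Rate and constant do not depend on \<open>f\<close>, which gives operator bounds
  later.\<close>

lemma abs_integral_extension_le: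
  "\<bar>integral_extension f y\<bar> \<le> exp growth * exp (growth * \<bar>y\<bar>) * norm f"
proof -
  obtain n x where n: "real n \<le> 1 + \<bar>y\<bar>" "x \<in> {0..1}" "y = x + real n \<or> y = 1 - x - real n"
  proof (cases "y \<ge> 0")
    case True
    then show ?thesis using unit_decomposition[of y] that by (metis abs_of_nonneg add_increasing zero_le_one)
  next
    case False
    then obtain n x where "1 - y = x + real n" "x \<in> {0..1}" "real n \<le> 1 - y"
      by (metis unit_decomposition diff_ge_0_iff_ge linorder_linear order_trans zero_le_one)
    then show ?thesis using False by (intro that[of n x]) auto
  qed
  then have "\<bar>integral_extension f y\<bar> \<le> exp (growth * n) * norm f"
    using integral_extension_simps[OF n(2), of f n] abs_ext_le[OF n(2), of f n] by auto
  also have "\<dots> \<le> exp (growth * (1 + \<bar>y\<bar>)) * norm f"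
    using n growth_pos by (intro mult_right_mono) auto
  finally show ?thesis by (simp add: algebra_simps exp_add)
qed

lemma moment_extension_lincomb:
  assumes "moment_extension F" "moment_extension G"
  shows "moment_extension (\<lambda>x. a * F x + b * G x)"
proof -
  have "continuous_on UNIV F" "continuous_on UNIV G"
    using assms by (auto simp: moment_extension_def)
  then have "shift_integral (\<lambda>x. a * F x + b * G x) t = a * shift_integral F t + b * shift_integral G t" for t
    unfolding shift_integral_def
    by (subst integral_mult_right[symmetric] )+
       (subst integral_add[symmetric]; auto intro!: integrable_continuous_real continuous_intros
         continuous_on_UNIV_compose[of F] continuous_on_UNIV_compose[of G] integral_cong simp: algebra_simps)
  moreover have "a * F (1 + t) + b * G (1 + t) - (a * F (1 - t) + b * G (1 - t)) =
     a * (F (1 + t) - F (1 - t)) + b * (G (1 + t) - G (1 - t))" for t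
    by (simp add: algebra_simps)
  ultimately show ?thesis
    using assms unfolding moment_extension_def
    by (auto intro!: continuous_intros) (simp add: algebra_simps)
qed

lemma fun_of_simps [simp]:
  "fun_of (f + g) x = fun_of f x + fun_of g x" "fun_of (f - g) x = fun_of f x - fun_of g x"
  "fun_of (c *\<^sub>R f) x = c * fun_of f x" "fun_of 0 x = 0" "fun_of (- f) x = - fun_of f x"
  by (simp_all add: fun_of_def plus_bcontfun.rep_eq minus_bcontfun.rep_eq scaleR_bcontfun.rep_eq
      zero_bcontfun.rep_eq uminus_bcontfun.rep_eq)

lemma norm_C01_le:
  assumes "\<And>x. x \<in> {0..1} \<Longrightarrow> \<bar>fun_of f x\<bar> \<le> B"
  shows "norm f \<le> B"
proof (rule norm_bound)
  fix u show "norm (apply_bcontfun f u) \<le> B"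
    using assms[of "of_unit u"] of_unit[of u] by (simp add: fun_of_def of_unit_inverse)
qed

lemma integral_extension_lincomb:
  "integral_extension (a *\<^sub>R f + b *\<^sub>R g) = (\<lambda>x. a * integral_extension f x + b * integral_extension g x)"
  by (rule integral_extension_unique)
     (auto intro!: moment_extension_lincomb moment_extension_integral_extension simp: integral_extension_unit)

section \<open>Convolution with symmetric measures\<close>

text \<open>The rate \<open>c\<close> ranges over all reals because weights \<open>r ^ i\<close> are
  absorbed into it and Gaussian dilations rescale it; \<open>c = 0\<close> yields finiteness of the
  measure.\<close>

definition exp_integrable :: "real measure \<Rightarrow> bool"
  where "exp_integrable \<mu> \<longleftrightarrow> sets \<mu> = sets borel \<and> (\<forall>c. integrable \<mu> (\<lambda>s. exp (c * \<bar>s\<bar>)))"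

lemma exp_integrable_finite: "exp_integrable \<mu> \<Longrightarrow> finite_measure \<mu>"
proof -
  assume "exp_integrable \<mu>"
  then have "integrable \<mu> (\<lambda>s. exp (0 * \<bar>s\<bar>))" unfolding exp_integrable_def by blast
  then have "integrable \<mu> (\<lambda>s. 1 :: real)" by simp
  then show ?thesis
    by (subst (asm) Bochner_Integration.integrable_iff_bounded)
       (auto intro!: finite_measureI simp: less_top)
qed

lemma exp_integrable_bound:
  assumes "exp_integrable \<mu>" "\<phi> \<in> borel_measurable borel" "\<And>s. \<bar>\<phi> s\<bar> \<le> M * exp (c * \<bar>s\<bar>)"
  shows "integrable \<mu> \<phi>" "\<bar>LINT s|\<mu>. \<phi> s\<bar> \<le> M * (LINT s|\<mu>. exp (c * \<bar>s\<bar>))"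
proof -
  have int: "integrable \<mu> (\<lambda>s. M * exp (c * \<bar>s\<bar>))"
    using assms(1) by (auto simp: exp_integrable_def)
  have meas: "\<phi> \<in> borel_measurable \<mu>"
    using assms(1,2) by (simp add: exp_integrable_def cong: measurable_cong_sets)
  show "integrable \<mu> \<phi>"
    by (rule Bochner_Integration.integrable_bound[OF int meas])
       (use assms(3) in \<open>auto intro: order_trans[OF _ abs_ge_self]\<close>)
  have "\<bar>LINT s|\<mu>. \<phi> s\<bar> \<le> (LINT s|\<mu>. M * exp (c * \<bar>s\<bar>))"
    using Bochner_Integration.integral_norm_bound_integral[OF \<open>integrable \<mu> \<phi>\<close> int] assms(3) by simp
  then show "\<bar>LINT s|\<mu>. \<phi> s\<bar> \<le> M * (LINT s|\<mu>. exp (c * \<bar>s\<bar>))" by simp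
qed

definition exp_bounded :: "(real \<Rightarrow> real) \<Rightarrow> bool"
  where "exp_bounded F \<longleftrightarrow> (\<exists>M c. 0 \<le> M \<and> 0 \<le> c \<and> (\<forall>x. \<bar>F x\<bar> \<le> M * exp (c * \<bar>x\<bar>)))"

lemma exp_abs_add_le:
  fixes x s :: real
  assumes "0 \<le> c" "0 \<le> M"
  shows "M * exp (c * \<bar>x + s\<bar>) \<le> M * exp (c * \<bar>x\<bar>) * exp (c * \<bar>s\<bar>)"
proof -
  have "exp (c * \<bar>x + s\<bar>) \<le> exp (c * \<bar>x\<bar> + c * \<bar>s\<bar>)"
    using assms by (simp add: mult_left_mono flip: distrib_left)
  then show ?thesis
    using mult_left_mono[OF _ assms(2)] by (simp add: exp_add mult.assoc)
qed

lemma moment_extension_eq: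
  assumes "moment_extension F"
  shows "integral_extension (C01_of F) = F"
proof (rule integral_extension_unique[OF assms])
  show "F x = fun_of (C01_of F) x" if "x \<in> {0..1}" for x
    using that assms unfolding moment_extension_def
    by (subst fun_of_C01_of) (auto intro: continuous_on_subset)
qed

lemma moment_extension_continuous: "moment_extension F \<Longrightarrow> continuous_on UNIV F"
  by (simp add: moment_extension_def)

text \<open>The conditions alone force the bound, since such an \<open>F\<close> is the extension of
  its own restriction to the unit interval.\<close>

lemma moment_extension_exp_bounded:
  assumes "moment_extension F"
  shows "exp_bounded F"
proof -
  have "\<bar>F y\<bar> \<le> exp growth * norm (C01_of F) * exp (growth * \<bar>y\<bar>)" for y
    using abs_integral_extension_le[of "C01_of F" y] moment_extension_eq[OF assms]
    by (simp add: mult_ac)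
  then show ?thesis
    unfolding exp_bounded_def using growth_pos
    by (intro exI[of _ "exp growth * norm (C01_of F)"] exI[of _ growth]) auto
qed

text \<open>With the plus sign this is convolution with the reflected measure, which is the same
  thing for the symmetric measures to which it is mainly applied, and it spares sign
  changes.\<close>

definition conv :: "real measure \<Rightarrow> (real \<Rightarrow> real) \<Rightarrow> real \<Rightarrow> real"
  where "conv \<mu> F x = (LINT s|\<mu>. F (x + s))"

lemma conv_bounds:
  assumes "exp_integrable \<mu>" "continuous_on UNIV F" "0 \<le> M" "0 \<le> c"
    and "\<And>x. \<bar>F x\<bar> \<le> M * exp (c * \<bar>x\<bar>)"
  shows "integrable \<mu> (\<lambda>s. F (x + s))"
    and "\<bar>conv \<mu> F x\<bar> \<le> M * exp (c * \<bar>x\<bar>) * (LINT s|\<mu>. exp (c * \<bar>s\<bar>))"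
proof -
  have "(\<lambda>s. F (x + s)) \<in> borel_measurable borel"
    by (intro borel_measurable_continuous_onI continuous_on_UNIV_compose[OF assms(2)] continuous_intros)
  moreover have "\<bar>F (x + s)\<bar> \<le> M * exp (c * \<bar>x\<bar>) * exp (c * \<bar>s\<bar>)" for s
    using assms(5)[of "x + s"] exp_abs_add_le[OF assms(4,3), of x s] by linarith
  ultimately show "integrable \<mu> (\<lambda>s. F (x + s))"
    "\<bar>conv \<mu> F x\<bar> \<le> M * exp (c * \<bar>x\<bar>) * (LINT s|\<mu>. exp (c * \<bar>s\<bar>))"
    unfolding conv_def by (rule exp_integrable_bound[OF assms(1)])+
qed

lemma integrable_shift:
  assumes "exp_integrable \<mu>" "continuous_on UNIV F" "exp_bounded F"
  shows "integrable \<mu> (\<lambda>s. F (x + s))"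
proof -
  obtain M c where "0 \<le> M" "0 \<le> c" "\<And>x. \<bar>F x\<bar> \<le> M * exp (c * \<bar>x\<bar>)"
    using assms(3) by (auto simp: exp_bounded_def)
  from conv_bounds(1)[OF assms(1,2) this] show ?thesis .
qed

text \<open>Dominated convergence along a convergent sequence: its bound \<open>R\<close> gives one
  exponential majorant for all translates.\<close>

lemma continuous_on_conv:
  assumes "exp_integrable \<mu>" "continuous_on UNIV F" "exp_bounded F"
  shows "continuous_on UNIV (conv \<mu> F)"
proof -
  obtain M c where F: "0 \<le> M" "0 \<le> c" "\<And>x. \<bar>F x\<bar> \<le> M * exp (c * \<bar>x\<bar>)"
    using assms(3) by (auto simp: exp_bounded_def)
  have "(conv \<mu> F \<circ> u) \<longlonglongrightarrow> conv \<mu> F x" if u: "u \<longlonglongrightarrow> x" for u x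
  proof -
    have "Bseq u" using u by (rule convergent_imp_Bseq[OF convergentI])
    then obtain R where R: "\<And>n. \<bar>u n\<bar> \<le> R" by (auto simp: Bseq_def)
    have "(\<lambda>n. conv \<mu> F (u n)) \<longlonglongrightarrow> conv \<mu> F x"
      unfolding conv_def
    proof (rule integral_dominated_convergence[where w = "\<lambda>s. M * exp (c * R) * exp (c * \<bar>s\<bar>)"])
      show "integrable \<mu> (\<lambda>s. M * exp (c * R) * exp (c * \<bar>s\<bar>))"
        using assms(1) by (auto simp: exp_integrable_def)
      show "(\<lambda>s. F (x + s)) \<in> borel_measurable \<mu>" "(\<lambda>s. F (u n + s)) \<in> borel_measurable \<mu>" for n
        using integrable_shift[OF assms] by blast+
      show "AE s in \<mu>. (\<lambda>n. F (u n + s)) \<longlonglongrightarrow> F (x + s)"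
        by (intro AE_I2 continuous_on_tendsto_compose[OF assms(2)] tendsto_intros u) auto
      show "AE s in \<mu>. norm (F (u n + s)) \<le> M * exp (c * R) * exp (c * \<bar>s\<bar>)" for n
      proof (rule AE_I2)
        fix s
        have "\<bar>F (u n + s)\<bar> \<le> M * exp (c * \<bar>u n\<bar>) * exp (c * \<bar>s\<bar>)"
          using F(3)[of "u n + s"] exp_abs_add_le[OF F(2,1), of "u n" s] by linarith
        also have "\<dots> \<le> M * exp (c * R) * exp (c * \<bar>s\<bar>)"
          using F R by (intro mult_right_mono mult_left_mono) (auto intro: mult_left_mono)
        finally show "norm (F (u n + s)) \<le> M * exp (c * R) * exp (c * \<bar>s\<bar>)" by simp
      qed
    qed
    then show ?thesis by (simp add: o_def)
  qed
  then show ?thesis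
    by (auto simp: continuous_on_eq_continuous_at continuous_at_sequentially)
qed

lemma exp_integrable_Fubini:
  assumes \<mu>: "exp_integrable \<mu>" and \<nu>: "exp_integrable \<nu>"
    and meas: "case_prod \<Phi> \<in> borel_measurable (borel \<Otimes>\<^sub>M borel)"
    and bound: "\<And>r s. \<bar>\<Phi> r s\<bar> \<le> M * exp (c * \<bar>r\<bar>) * exp (c * \<bar>s\<bar>)"
  shows "(LINT r|\<nu>. LINT s|\<mu>. \<Phi> r s) = (LINT s|\<mu>. LINT r|\<nu>. \<Phi> r s)"
    and "integrable (\<nu> \<Otimes>\<^sub>M \<mu>) (case_prod \<Phi>)"
proof -
  interpret \<mu>: finite_measure \<mu> by (rule exp_integrable_finite[OF \<mu>])
  interpret \<nu>: finite_measure \<nu> by (rule exp_integrable_finite[OF \<nu>])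
  interpret pair_sigma_finite \<nu> \<mu> ..
  have sets: "sets \<mu> = sets borel" "sets \<nu> = sets borel"
    using \<mu> \<nu> by (auto simp: exp_integrable_def)
  have meas': "case_prod \<Phi> \<in> borel_measurable (\<nu> \<Otimes>\<^sub>M \<mu>)"
    using meas by (simp add: sets cong: measurable_cong_sets sets_pair_measure_cong)
  have exps: "(\<lambda>s. exp (c * \<bar>s\<bar>)) \<in> borel_measurable \<mu>" "(\<lambda>s. exp (c * \<bar>s\<bar>)) \<in> borel_measurable \<nu>"
    by (simp_all add: sets cong: measurable_cong_sets)
  have prod: "integrable (\<nu> \<Otimes>\<^sub>M \<mu>) (\<lambda>(r, s). M * exp (c * \<bar>r\<bar>) * exp (c * \<bar>s\<bar>))"
  proof (rule Fubini_integrable)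
    have [measurable]: "(\<lambda>s. exp (c * \<bar>s\<bar>)) \<in> borel_measurable \<mu>"
      "(\<lambda>s. exp (c * \<bar>s\<bar>)) \<in> borel_measurable \<nu>" by (fact exps)+
    show "(\<lambda>(r, s). M * exp (c * \<bar>r\<bar>) * exp (c * \<bar>s\<bar>)) \<in> borel_measurable (\<nu> \<Otimes>\<^sub>M \<mu>)"
      by measurable
    show "integrable \<nu> (\<lambda>r. LINT s|\<mu>. norm (case (r, s) of (r, s) \<Rightarrow> M * exp (c * \<bar>r\<bar>) * exp (c * \<bar>s\<bar>)))"
      using \<nu> by (auto simp: exp_integrable_def abs_mult)
    show "AE r in \<nu>. integrable \<mu> (\<lambda>s. case (r, s) of (r, s) \<Rightarrow> M * exp (c * \<bar>r\<bar>) * exp (c * \<bar>s\<bar>))"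
      using \<mu> by (auto simp: exp_integrable_def)
  qed
  show "integrable (\<nu> \<Otimes>\<^sub>M \<mu>) (case_prod \<Phi>)"
    by (rule Bochner_Integration.integrable_bound[OF prod meas'])
       (use bound in \<open>auto intro!: order_trans[OF _ abs_ge_self]\<close>)
  from Fubini_integral[OF this] show "(LINT r|\<nu>. LINT s|\<mu>. \<Phi> r s) = (LINT s|\<mu>. LINT r|\<nu>. \<Phi> r s)"
    by simp
qed

text \<open>One Fubini exchange for several purposes: weight 0 gives commutation and composition of
  convolutions, while weights 0 and 1 against the uniform law on the unit interval give moments of a
  convolution.\<close>

lemma conv_commute_weighted:
  assumes \<mu>: "exp_integrable \<mu>" and \<nu>: "exp_integrable \<nu>" and F: "continuous_on UNIV F" "exp_bounded F"
  shows "(LINT r|\<nu>. r ^ i * conv \<mu> F (x + r)) = (LINT s|\<mu>. LINT r|\<nu>. r ^ i * F (x + r + s))"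
    and "integrable (\<nu> \<Otimes>\<^sub>M \<mu>) (\<lambda>(r, s). r ^ i * F (x + r + s))"
proof -
  obtain M c where M: "0 \<le> M" "0 \<le> c" "\<And>x. \<bar>F x\<bar> \<le> M * exp (c * \<bar>x\<bar>)"
    using F(2) by (auto simp: exp_bounded_def)
  \<comment> \<open>The weight only raises the exponential rate by \<open>i\<close>, so the product
    majorant of \<open>exp_integrable_Fubini\<close> still applies.\<close>
  have pow: "\<bar>r\<bar> ^ i \<le> exp (real i * \<bar>r\<bar>)" for r :: real
  proof -
    have "\<bar>r\<bar> \<le> exp \<bar>r\<bar>" using exp_ge_add_one_self[of "\<bar>r\<bar>"] by linarith
    from power_mono[OF this, of i] show ?thesis by (simp add: exp_of_nat_mult)
  qed
  have bound: "\<bar>r ^ i * F (x + r + s)\<bar>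
      \<le> (M * exp (c * \<bar>x\<bar>)) * exp ((c + i) * \<bar>r\<bar>) * exp ((c + i) * \<bar>s\<bar>)" for r s
  proof -
    have "\<bar>F (x + r + s)\<bar> \<le> M * exp (c * \<bar>x\<bar>) * exp (c * \<bar>r\<bar>) * exp (c * \<bar>s\<bar>)"
    proof -
      have "\<bar>F (x + r + s)\<bar> \<le> M * exp (c * \<bar>x + r\<bar>) * exp (c * \<bar>s\<bar>)"
        using M(3)[of "x + r + s"] exp_abs_add_le[OF M(2,1), of "x + r" s] by linarith
      also have "\<dots> \<le> M * exp (c * \<bar>x\<bar>) * exp (c * \<bar>r\<bar>) * exp (c * \<bar>s\<bar>)"
        by (intro mult_right_mono exp_abs_add_le M) auto
      finally show ?thesis .
    qed
    then have "\<bar>r\<bar> ^ i * \<bar>F (x + r + s)\<bar>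
        \<le> exp (i * \<bar>r\<bar>) * (M * exp (c * \<bar>x\<bar>) * exp (c * \<bar>r\<bar>) * exp (c * \<bar>s\<bar>))"
      by (intro mult_mono[OF pow]) auto
    also have "\<dots> = (M * exp (c * \<bar>x\<bar>)) * exp ((c + i) * \<bar>r\<bar>) * exp (c * \<bar>s\<bar>)"
      by (simp add: algebra_simps exp_add)
    also have "\<dots> \<le> (M * exp (c * \<bar>x\<bar>)) * exp ((c + i) * \<bar>r\<bar>) * exp ((c + i) * \<bar>s\<bar>)"
      using M by (intro mult_left_mono) (auto intro: mult_right_mono)
    finally show ?thesis by (simp add: abs_mult power_abs)
  qed
  have [measurable]: "F \<in> borel_measurable borel"
    by (rule borel_measurable_continuous_onI[OF F(1)])
  have meas: "(\<lambda>(r, s). r ^ i * F (x + r + s)) \<in> borel_measurable (borel \<Otimes>\<^sub>M borel)"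
    by measurable
  note Fub = exp_integrable_Fubini[OF \<mu> \<nu> meas bound]
  show "integrable (\<nu> \<Otimes>\<^sub>M \<mu>) (\<lambda>(r, s). r ^ i * F (x + r + s))" by (rule Fub)
  show "(LINT r|\<nu>. r ^ i * conv \<mu> F (x + r)) = (LINT s|\<mu>. LINT r|\<nu>. r ^ i * F (x + r + s))"
    using Fub(1) by (simp add: conv_def)
qed

lemma conv_commute:
  assumes "exp_integrable \<mu>" "exp_integrable \<nu>" "continuous_on UNIV F" "exp_bounded F"
  shows "conv \<nu> (conv \<mu> F) = conv \<mu> (conv \<nu> F)"
proof
  fix x
  show "conv \<nu> (conv \<mu> F) x = conv \<mu> (conv \<nu> F) x"
    using conv_commute_weighted(1)[OF assms, of 0 x]
    by (simp add: conv_def add_ac)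
qed

lemma conv_convolution:
  assumes "exp_integrable \<mu>" "exp_integrable \<nu>" "continuous_on UNIV F" "exp_bounded F"
  shows "conv \<nu> (conv \<mu> F) = conv (convolution \<nu> \<mu>) F"
proof
  fix x
  interpret \<mu>: finite_measure \<mu> by (rule exp_integrable_finite[OF assms(1)])
  interpret \<nu>: finite_measure \<nu> by (rule exp_integrable_finite[OF assms(2)])
  interpret pair_sigma_finite \<nu> \<mu> ..
  have sets: "sets (\<nu> \<Otimes>\<^sub>M \<mu>) = sets (borel \<Otimes>\<^sub>M borel)"
    using assms(1,2) by (intro sets_pair_measure_cong) (auto simp: exp_integrable_def)
  have "conv (convolution \<nu> \<mu>) F x = (LINT p|(\<nu> \<Otimes>\<^sub>M \<mu>). F (x + (case p of (r, s) \<Rightarrow> r + s)))"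
    unfolding conv_def convolution_def
  proof (rule integral_distr)
    have "(\<lambda>(r, s). r + s :: real) \<in> borel_measurable (borel \<Otimes>\<^sub>M borel)" by measurable
    then show "(\<lambda>(r, s). r + s) \<in> borel_measurable (\<nu> \<Otimes>\<^sub>M \<mu>)"
      by (simp only: measurable_cong_sets[OF sets refl])
    show "(\<lambda>s. F (x + s)) \<in> borel_measurable borel"
      by (intro borel_measurable_continuous_onI continuous_on_UNIV_compose[OF assms(3)] continuous_intros)
  qed
  also have "\<dots> = (LINT p|(\<nu> \<Otimes>\<^sub>M \<mu>). (case p of (r, s) \<Rightarrow> F (x + r + s)))"
    by (intro Bochner_Integration.integral_cong) (auto simp: add_ac)
  also have "\<dots> = (LINT r|\<nu>. LINT s|\<mu>. F (x + r + s))"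
    using integral_fst'[OF conv_commute_weighted(2)[OF assms, of 0 x]] by simp
  finally show "conv \<nu> (conv \<mu> F) x = conv (convolution \<nu> \<mu>) F x"
    by (simp add: conv_def)
qed

section \<open>Symmetric measures preserve the moment conditions\<close>

definition symmetric :: "real measure \<Rightarrow> bool"
  where "symmetric \<mu> \<longleftrightarrow> prob_space \<mu> \<and> exp_integrable \<mu> \<and> distr \<mu> borel uminus = \<mu>"

lemma symmetric_exp_integrable: "symmetric \<mu> \<Longrightarrow> exp_integrable \<mu>"
  by (simp add: symmetric_def)

lemma integral_symmetric:
  fixes \<phi> :: "real \<Rightarrow> real"
  assumes "symmetric \<mu>" "integrable \<mu> \<phi>"
  shows "integrable \<mu> (\<lambda>s. \<phi> (- s))" "(LINT s|\<mu>. \<phi> (- s)) = (LINT s|\<mu>. \<phi> s)"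
proof -
  have \<mu>: "distr \<mu> borel uminus = \<mu>" "sets \<mu> = sets borel"
    using assms(1) by (simp_all add: symmetric_def exp_integrable_def)
  then have m: "uminus \<in> measurable \<mu> (borel :: real measure)" "\<phi> \<in> borel_measurable borel"
    using borel_measurable_integrable[OF assms(2)] by (simp_all cong: measurable_cong_sets)
  show "integrable \<mu> (\<lambda>s. \<phi> (- s))"
    using integrable_distr[of uminus \<mu> borel \<phi>] assms(2) m \<mu> by simp
  show "(LINT s|\<mu>. \<phi> (- s)) = (LINT s|\<mu>. \<phi> s)"
    using integral_distr[OF m] \<mu> by simp
qed

text \<open>Two roles: \<open>uniform 0 1\<close> presents integration over the unit interval as
  integration against a finite measure, and \<open>uniform (- h) h\<close> is the smoothing average
  used for fixed points.\<close>

abbreviation uniform :: "real \<Rightarrow> real \<Rightarrow> real measure"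
  where "uniform a b \<equiv> uniform_measure lborel {a..b}"

lemma integral_uniform:
  fixes \<phi> :: "real \<Rightarrow> real"
  assumes "a < b" "continuous_on UNIV \<phi>"
  shows "integrable (uniform a b) \<phi>" "(LINT s|uniform a b. \<phi> s) = integral {a..b} \<phi> / (b - a)"
proof -
  have int: "set_integrable lborel {a..b} \<phi>"
    by (rule borel_integrable_atLeastAtMost') (rule continuous_on_subset[OF assms(2)], simp)
  have eq: "uniform a b = density lborel (\<lambda>x. ennreal (indicator {a..b} x / (b - a)))"
    unfolding uniform_measure_def using assms(1)
    by (intro arg_cong[where f = "density lborel"] ext)
       (auto simp: divide_ennreal indicator_def simp flip: ennreal_1)
  have meas: "\<phi> \<in> borel_measurable lborel"
    using borel_measurable_continuous_onI[OF assms(2)] by simp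
  have eq2: "(\<lambda>x. (indicator {a..b} x / (b - a)) *\<^sub>R \<phi> x) = (\<lambda>x. (indicator {a..b} x *\<^sub>R \<phi> x) * (1 / (b - a)))"
    by auto
  show "integrable (uniform a b) \<phi>"
    unfolding eq using int assms(1)
    by (subst integrable_density[OF meas]) (auto simp: eq2 set_integrable_def indicator_def)
  have "(LINT s|uniform a b. \<phi> s) = (LINT x|lborel. (indicator {a..b} x / (b - a)) *\<^sub>R \<phi> x)"
    unfolding eq using assms(1) by (subst integral_density[OF meas]) auto
  also have "\<dots> = (LINT x:{a..b}|lborel. \<phi> x) * (1 / (b - a))"
    unfolding eq2 set_lebesgue_integral_def by simp
  also have "(LINT x:{a..b}|lborel. \<phi> x) = integral {a..b} \<phi>"
    by (rule set_borel_integral_eq_integral(2)[OF int])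
  finally show "(LINT s|uniform a b. \<phi> s) = integral {a..b} \<phi> / (b - a)" by simp
qed

lemma exp_integrable_uniform:
  assumes "a < b"
  shows "exp_integrable (uniform a b)"
  unfolding exp_integrable_def
proof (intro conjI allI)
  show "integrable (uniform a b) (\<lambda>s. exp (c * \<bar>s\<bar>))" for c
    by (rule integral_uniform[OF assms]) (auto intro!: continuous_intros)
qed simp

lemma symmetric_uniform:
  assumes "h > 0"
  shows "symmetric (uniform (- h) h)"
  unfolding symmetric_def
proof (intro conjI)
  show "prob_space (uniform (- h) h)"
    by (rule prob_space_uniform_measure) (use assms in auto)
  show "exp_integrable (uniform (- h) h)" by (rule exp_integrable_uniform) (use assms in simp)
  show "distr (uniform (- h) h) borel uminus = uniform (- h) h"
  proof (rule measure_eqI)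
    fix A :: "real set" assume "A \<in> sets (distr (uniform (- h) h) borel uminus)"
    then have A: "A \<in> sets borel" by simp
    have [measurable]: "uminus -` A \<in> sets borel"
      using measurable_sets_borel[of uminus borel A] A by simp
    have "emeasure (distr (uniform (- h) h) borel uminus) A = emeasure (uniform (- h) h) (uminus -` A)"
      by (subst emeasure_distr) (use A in \<open>auto cong: measurable_cong_sets\<close>)
    also have "\<dots> = emeasure lborel ({-h..h} \<inter> uminus -` A) / emeasure lborel {-h..h}"
      by (rule emeasure_uniform_measure) auto
    also have "emeasure lborel ({-h..h} \<inter> uminus -` A) = emeasure (distr lborel borel uminus) ({-h..h} \<inter> A)"
      using A by (subst emeasure_distr) (auto intro!: arg_cong[where f = "emeasure lborel"])
    also have "distr lborel borel uminus = (lborel :: real measure)"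
      by (rule lborel_distr_uminus)
    also have "emeasure lborel ({-h..h} \<inter> A) / emeasure lborel {-h..h} = emeasure (uniform (- h) h) A"
      using A by (subst emeasure_uniform_measure) auto
    finally show "emeasure (distr (uniform (- h) h) borel uminus) A = emeasure (uniform (- h) h) A" .
  qed simp
qed

lemma integral_weighted_conv:
  assumes \<mu>: "exp_integrable \<mu>" and F: "continuous_on UNIV F" "exp_bounded F"
  shows "integral {0..1} (\<lambda>x. x ^ i * conv \<mu> F (x + t)) = (LINT s|\<mu>. integral {0..1} (\<lambda>x. x ^ i * F (x + t + s)))"
    and "integrable \<mu> (\<lambda>s. integral {0..1} (\<lambda>x. x ^ i * F (x + t + s)))"
proof -
  have u: "exp_integrable (uniform 0 1)" by (rule exp_integrable_uniform) simp
  have eq: "(LINT r|uniform 0 1. r ^ i * F (t + r + s)) = integral {0..1} (\<lambda>x. x ^ i * F (x + t + s))" for s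
    by (subst integral_uniform)
       (auto intro!: continuous_intros continuous_on_UNIV_compose[OF F(1)] simp: add_ac)
  have "(LINT r|uniform 0 1. r ^ i * conv \<mu> F (t + r)) = integral {0..1} (\<lambda>x. x ^ i * conv \<mu> F (x + t))"
    by (subst integral_uniform)
       (auto intro!: continuous_intros continuous_on_UNIV_compose[OF continuous_on_conv[OF \<mu> F]] simp: add_ac)
  then show "integral {0..1} (\<lambda>x. x ^ i * conv \<mu> F (x + t)) = (LINT s|\<mu>. integral {0..1} (\<lambda>x. x ^ i * F (x + t + s)))"
    using conv_commute_weighted(1)[OF \<mu> u F, of i t] by (simp add: eq)
  interpret \<mu>: finite_measure \<mu> by (rule exp_integrable_finite[OF \<mu>])
  interpret u: finite_measure "uniform 0 1" by (rule exp_integrable_finite[OF u])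
  interpret pair_sigma_finite "uniform 0 1" \<mu> ..
  show "integrable \<mu> (\<lambda>s. integral {0..1} (\<lambda>x. x ^ i * F (x + t + s)))"
    using integrable_snd[OF conv_commute_weighted(2)[OF \<mu> u F, of i t]] by (simp add: eq)
qed

text \<open>After reflecting \<open>s\<close> in the terms with argument \<open>x - t\<close>, the
  shift becomes \<open>t + s\<close> in every term. Each condition at \<open>t\<close> for the
  convolution is then the average over \<open>s\<close> of the condition at \<open>t + s\<close> for
  \<open>F\<close>.\<close>

lemma moment_extension_conv:
  assumes \<mu>: "symmetric \<mu>" and F: "moment_extension F"
  shows "moment_extension (conv \<mu> F)"
proof -
  note \<mu>' = symmetric_exp_integrable[OF \<mu>]
  have F1: "F (1 + t) - F (1 - t) = F t - F (- t)" and F2: "F (1 + t) - F (1 - t) = shift_integral F t" for t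
    using F by (auto simp: moment_extension_def)
  note cont = moment_extension_continuous[OF F] and bdd = moment_extension_exp_bounded[OF F]
  note int = integrable_shift[OF \<mu>' cont bdd]
  have mirror: "conv \<mu> F (x - t) = (LINT s|\<mu>. F (x - (t + s)))" "integrable \<mu> (\<lambda>s. F (x - (t + s)))" for x t
    using integral_symmetric[OF \<mu> int[of "x - t"]] by (simp_all add: conv_def diff_diff_eq)
  have eq: "conv \<mu> F (1 + t) - conv \<mu> F (1 - t) = (LINT s|\<mu>. F (1 + (t + s)) - F (1 - (t + s)))" for t
    using int[of "1 + t"] mirror[of 1 t] by (simp add: conv_def[of _ _ "1 + t"] add.assoc)
  have odd: "conv \<mu> F (1 + t) - conv \<mu> F (1 - t) = conv \<mu> F t - conv \<mu> F (- t)" for t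
  proof -
    have "conv \<mu> F (1 + t) - conv \<mu> F (1 - t) = (LINT s|\<mu>. F (t + s) - F (- (t + s)))"
      unfolding eq by (simp only: F1)
    also have "\<dots> = conv \<mu> F t - conv \<mu> F (- t)"
      using int[of t] mirror[of 0 t] by (simp add: conv_def[of _ _ t])
    finally show ?thesis .
  qed
  have cc: "continuous_on UNIV (conv \<mu> F)" by (rule continuous_on_conv[OF \<mu>' cont bdd])
  have J: "conv \<mu> F (1 + t) - conv \<mu> F (1 - t) = shift_integral (conv \<mu> F) t" for t
  proof -
    note w = integral_weighted_conv[OF \<mu>' cont bdd, where i = 0, simplified]
    have sI: "shift_integral G t = integral {0..1} (\<lambda>x. G (x + t)) - integral {0..1} (\<lambda>x. G (x - t))"
      if "continuous_on UNIV G" for G t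
      unfolding shift_integral_def
      by (intro integral_diff integrable_continuous_real continuous_on_UNIV_compose[OF that] continuous_intros)
    \<comment> \<open>\<open>shift_integral\<close> is split because only the half with argument
      \<open>x - t\<close> is to be reflected: \<open>P s\<close> and \<open>Q (- s)\<close>
      together form \<open>shift_integral F (t + s)\<close>.\<close>
    define P where "P s = integral {0..1} (\<lambda>x. F (x + t + s))" for s
    define Q where "Q s = integral {0..1} (\<lambda>x. F (x - t + s))" for s
    have P: "integrable \<mu> P" unfolding P_def by (rule w(2))
    have Q: "integrable \<mu> Q" unfolding Q_def using w(2)[of "- t"] by simp
    have "shift_integral (conv \<mu> F) t = (LINT s|\<mu>. P s) - (LINT s|\<mu>. Q s)"
      using w(1)[of t] w(1)[of "- t"] by (simp add: sI[OF cc] P_def Q_def)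
    also have "\<dots> = (LINT s|\<mu>. P s) - (LINT s|\<mu>. Q (- s))"
      using integral_symmetric(2)[OF \<mu> Q] by simp
    also have "\<dots> = (LINT s|\<mu>. P s - Q (- s))"
      by (rule Bochner_Integration.integral_diff[symmetric, OF P integral_symmetric(1)[OF \<mu> Q]])
    also have "\<dots> = (LINT s|\<mu>. shift_integral F (t + s))"
      by (simp add: sI[OF cont] P_def Q_def add.assoc diff_diff_eq)
    also have "\<dots> = conv \<mu> F (1 + t) - conv \<mu> F (1 - t)"
      unfolding eq by (simp only: F2)
    finally show ?thesis ..
  qed
  show ?thesis
    using cc odd J unfolding moment_extension_def by blast
qed

section \<open>The heat semigroup on the interval\<close>

text \<open>The symmetrised moment has zero derivative in \<open>t\<close> and is compared with
  \<open>t = 0\<close>. As \<open>F\<close> is merely continuous, the moments are first expressed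
  through antiderivatives; the derivative for order \<open>i\<close> is then exactly the defect of
  the corresponding condition.\<close>

lemma moment_extension_moments:
  assumes F: "moment_extension F" and "i \<le> 1"
  shows "integral {0..1} (\<lambda>x. x ^ i * F (x + t)) + integral {0..1} (\<lambda>x. x ^ i * F (x - t)) =
    2 * integral {0..1} (\<lambda>x. x ^ i * F x)"
proof -
  note cont = moment_extension_continuous[OF F]
  obtain G where G: "\<And>x. (G has_real_derivative F x) (at x)"
    using ex_antiderivative[OF cont] by blast
  obtain H where H: "\<And>x. (H has_real_derivative G x) (at x)"
    using ex_antiderivative[of G] DERIV_isCont[OF G] by (metis continuous_on_eq_continuous_at open_UNIV)
  have [derivative_intros]: "((\<lambda>x. G (x + c)) has_real_derivative F (x + c)) (at x)"
    "((\<lambda>x. H (x + c)) has_real_derivative G (x + c)) (at x)" for x c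
    using DERIV_shift G H by blast+
  have F1: "F (1 + t) - F (1 - t) = F t - F (- t)"
    and F2: "F (1 + t) - F (1 - t) = (G (1 + t) - G t) - (G (1 - t) - G (- t))" for t
    using F shift_integral_antiderivative[OF G] by (auto simp: moment_extension_def)
  consider "i = 0" | "i = 1" using assms(2) by linarith
  then show ?thesis
  proof cases
    case 1
    have int: "integral {0..1} (\<lambda>x. x ^ i * F (x + t)) = G (1 + t) - G t" for t
      using integral_eq_antiderivative[of "\<lambda>x. G (x + t)" "\<lambda>x. F (x + t)" 0 1] 1
      by (simp add: derivative_intros)
    define \<phi> where "\<phi> t = G (1 + t) - G t + (G (1 - t) - G (- t))" for t
    have "(\<phi> has_real_derivative F (1 + t) - F t + (- F (1 - t) + F (- t))) (at t)" for t
      unfolding \<phi>_def by (auto intro!: derivative_eq_intros DERIV_chain'[OF _ G])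
    then have "\<forall>t. (\<phi> has_real_derivative 0) (at t)"
      using F1 by (smt (verit) DERIV_cong)
    then have "\<phi> t = \<phi> 0" by (rule DERIV_isconst_all)
    then show ?thesis
      using int[of t] int[of "- t"] int[of 0] by (simp add: \<phi>_def)
  next
    case 2
    \<comment> \<open>Integration by parts in the form of an explicit antiderivative of
      \<open>x * F (x + t)\<close>.\<close>
    have D: "((\<lambda>x. x * G (x + t) - H (x + t)) has_real_derivative x * F (x + t)) (at x)" for x t
      by (auto intro!: derivative_eq_intros)
    have int: "integral {0..1} (\<lambda>x. x ^ i * F (x + t)) = G (1 + t) - H (1 + t) + H t" for t
      using integral_eq_antiderivative[OF D, of 0 1 t] 2 by simp
    define \<phi> where "\<phi> t = G (1 + t) - H (1 + t) + H t + (G (1 - t) - H (1 - t) + H (- t))" for t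
    have "(\<phi> has_real_derivative F (1 + t) - G (1 + t) + G t + (- F (1 - t) + G (1 - t) - G (- t))) (at t)" for t
      unfolding \<phi>_def by (auto intro!: derivative_eq_intros DERIV_chain'[OF _ G] DERIV_chain'[OF _ H])
    then have "\<forall>t. (\<phi> has_real_derivative 0) (at t)"
      using F2 by (smt (verit) DERIV_cong)
    then have "\<phi> t = \<phi> 0" by (rule DERIV_isconst_all)
    then show ?thesis
      using int[of t] int[of "- t"] int[of 0] by (simp add: \<phi>_def)
  qed
qed

section \<open>Convolutions as operators on C[0,1]\<close>

definition conv_C01 :: "real measure \<Rightarrow> C01 \<Rightarrow> C01"
  where "conv_C01 \<mu> f = C01_of (conv \<mu> (integral_extension f))"

lemmas integral_extension_facts =
  integral_extension(2) moment_extension_exp_bounded[OF moment_extension_integral_extension]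

text \<open>Restriction to the unit interval loses nothing: extending again recovers the convolution
  on the whole line. Composing these operators therefore means composing convolutions, which gives
  commutation and the semigroup law.\<close>

lemma integral_extension_conv_C01:
  assumes "symmetric \<mu>"
  shows "integral_extension (conv_C01 \<mu> f) = conv \<mu> (integral_extension f)"
  unfolding conv_C01_def
  by (intro moment_extension_eq moment_extension_conv assms moment_extension_integral_extension)

lemma fun_of_conv_C01:
  assumes "symmetric \<mu>" "x \<in> {0..1}"
  shows "fun_of (conv_C01 \<mu> f) x = conv \<mu> (integral_extension f) x"
  using integral_extension_unit[OF assms(2), of "conv_C01 \<mu> f"]
  by (simp add: integral_extension_conv_C01[OF assms(1)])

text \<open>One factor \<open>exp growth\<close> is the constant of the extension bound, the other
  bounds \<open>exp (growth * \<bar>x\<bar>)\<close> on the unit interval.\<close>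

lemma norm_conv_C01_le:
  assumes "symmetric \<mu>"
  shows "norm (conv_C01 \<mu> f) \<le> norm f * (exp (2 * growth) * (LINT s|\<mu>. exp (growth * \<bar>s\<bar>)))"
proof (rule norm_C01_le)
  fix x :: real assume x: "x \<in> {0..1}"
  have I: "(LINT s|\<mu>. exp (growth * \<bar>s\<bar>)) \<ge> 0" by simp
  have "\<bar>conv \<mu> (integral_extension f) x\<bar> \<le>
      (exp growth * norm f) * exp (growth * \<bar>x\<bar>) * (LINT s|\<mu>. exp (growth * \<bar>s\<bar>))"
    by (rule conv_bounds(2)[OF symmetric_exp_integrable[OF assms] integral_extension(2)])
       (use growth_pos abs_integral_extension_le[of f] in \<open>auto simp: mult_ac\<close>)
  also have "\<dots> \<le> (exp growth * norm f) * exp growth * (LINT s|\<mu>. exp (growth * \<bar>s\<bar>))"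
    using x growth_pos by (intro mult_right_mono mult_left_mono) auto
  finally show "\<bar>fun_of (conv_C01 \<mu> f) x\<bar> \<le> norm f * (exp (2 * growth) * (LINT s|\<mu>. exp (growth * \<bar>s\<bar>)))"
    using exp_add[of growth growth] by (simp add: fun_of_conv_C01[OF assms x] mult_ac)
qed

lemma conv_C01_lincomb:
  assumes "symmetric \<mu>"
  shows "conv_C01 \<mu> (a *\<^sub>R f + b *\<^sub>R g) = a *\<^sub>R conv_C01 \<mu> f + b *\<^sub>R conv_C01 \<mu> g"
proof (rule C01_eqI)
  fix x :: real assume x: "x \<in> {0..1}"
  note int = integrable_shift[OF symmetric_exp_integrable[OF assms] integral_extension_facts]
  show "fun_of (conv_C01 \<mu> (a *\<^sub>R f + b *\<^sub>R g)) x = fun_of (a *\<^sub>R conv_C01 \<mu> f + b *\<^sub>R conv_C01 \<mu> g) x"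
    using int by (simp add: fun_of_conv_C01[OF assms x] conv_def integral_extension_lincomb)
qed

lemma bounded_linear_conv_C01:
  assumes "symmetric \<mu>"
  shows "bounded_linear (conv_C01 \<mu>)"
proof (rule bounded_linear_intro)
  show "conv_C01 \<mu> (f + g) = conv_C01 \<mu> f + conv_C01 \<mu> g" for f g
    using conv_C01_lincomb[OF assms, of 1 f 1 g] by simp
  show "conv_C01 \<mu> (a *\<^sub>R f) = a *\<^sub>R conv_C01 \<mu> f" for a f
    using conv_C01_lincomb[OF assms, of a f 0 f] by simp
qed (rule norm_conv_C01_le[OF assms])

lemma conv_C01_commute:
  assumes "symmetric \<mu>" "symmetric \<nu>"
  shows "conv_C01 \<mu> (conv_C01 \<nu> f) = conv_C01 \<nu> (conv_C01 \<mu> f)"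
  unfolding conv_C01_def[of _ "conv_C01 _ _"] integral_extension_conv_C01[OF assms(1)]
    integral_extension_conv_C01[OF assms(2)]
  using conv_commute[OF assms[THEN symmetric_exp_integrable] integral_extension_facts] by simp

text \<open>The moment of a single translate may change; its sum with the opposite translate is
  twice the original moment. Symmetry of the measure pairs them, and total mass 1 removes the
  measure.\<close>

lemma moment_conv_C01:
  assumes \<mu>: "symmetric \<mu>" and i: "i \<le> 1"
  shows "moment i (conv_C01 \<mu> f) = moment i f"
proof -
  let ?F = "integral_extension f"
  interpret prob_space \<mu> using \<mu> by (simp add: symmetric_def)
  define P where "P s = integral {0..1} (\<lambda>x. x ^ i * ?F (x + s))" for s
  have mom: "moment i g = integral {0..1} (\<lambda>x. x ^ i * integral_extension g x)" for g
    unfolding moment_def by (intro integral_cong) (simp add: integral_extension_unit)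
  note w = integral_weighted_conv[OF symmetric_exp_integrable[OF \<mu>] integral_extension_facts[of f], of i 0]
  have P: "integrable \<mu> P" using w(2) by (simp add: P_def[abs_def])
  have "2 * (LINT s|\<mu>. P s) = (LINT s|\<mu>. P s + P (- s))"
    using integral_symmetric[OF \<mu> P] P by simp
  also have "\<dots> = (LINT s|\<mu>. 2 * moment i f)"
    using moment_extension_moments[OF moment_extension_integral_extension i, of f]
    by (simp add: P_def mom)
  also have "\<dots> = 2 * moment i f" by (simp add: prob_space)
  finally have "(LINT s|\<mu>. P s) = moment i f" by simp
  moreover have "moment i (conv_C01 \<mu> f) = (LINT s|\<mu>. P s)"
    using w(1) by (simp add: mom integral_extension_conv_C01[OF \<mu>] P_def)
  ultimately show ?thesis by simp
qed

section \<open>The Gaussian law with variance \<open>2 * t\<close>\<close>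

definition gauss :: "real \<Rightarrow> real measure"
  where "gauss t = distr std_normal_distribution borel (\<lambda>z. sqrt (2 * t) * z)"

lemma prob_space_std_normal: "prob_space std_normal_distribution"
  by (rule prob_space_normal_density) simp

text \<open>Completing the square turns the tilted density into a shifted normal density times
  \<open>exp (c\<^sup>2 / 2)\<close>; the absolute value is handled by adding the tilts
  \<open>c\<close> and \<open>- c\<close>.\<close>

lemma exp_integrable_std_normal: "exp_integrable std_normal_distribution"
  unfolding exp_integrable_def
proof (intro conjI allI)
  fix c :: real
  have eq: "std_normal_density x * exp (c * x) = exp (c\<^sup>2 / 2) * normal_density c 1 x" for c x
    by (simp add: normal_density_def mult_exp_exp power2_eq_square field_simps)
  have "integrable lborel (\<lambda>x. std_normal_density x * exp (c * x) + std_normal_density x * exp (- c * x))"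
    unfolding eq by (intro Bochner_Integration.integrable_add integrable_mult_right integrable_normal_density) simp_all
  then have "integrable lborel (\<lambda>x. std_normal_density x * exp (c * \<bar>x\<bar>))"
  proof (rule Bochner_Integration.integrable_bound)
    show "AE x in lborel. norm (std_normal_density x * exp (c * \<bar>x\<bar>))
        \<le> norm (std_normal_density x * exp (c * x) + std_normal_density x * exp (- c * x))"
    proof (rule AE_I2)
      fix x
      have "exp (c * \<bar>x\<bar>) \<le> exp (c * x) + exp (- c * x)" by (cases "x \<ge> 0") auto
      then have "std_normal_density x * exp (c * \<bar>x\<bar>)
          \<le> std_normal_density x * (exp (c * x) + exp (- c * x))"
        by (intro mult_left_mono) auto
      then show "norm (std_normal_density x * exp (c * \<bar>x\<bar>))
          \<le> norm (std_normal_density x * exp (c * x) + std_normal_density x * exp (- c * x))"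
        by (simp add: distrib_left abs_mult)
    qed
  qed simp
  then show "integrable std_normal_distribution (\<lambda>s. exp (c * \<bar>s\<bar>))"
    by (subst integrable_density) auto
qed simp

lemma distr_std_normal:
  assumes "a \<noteq> 0"
  shows "distr std_normal_distribution borel (\<lambda>z. a * z) = density lborel (normal_density 0 \<bar>a\<bar>)"
proof -
  interpret prob_space std_normal_distribution by (rule prob_space_std_normal)
  have "distr std_normal_distribution lborel (\<lambda>z. z) = density lborel std_normal_density"
    by (simp add: distr_id2)
  then have "distributed std_normal_distribution lborel (\<lambda>z. z) (normal_density 0 1)"
    by (auto simp: distributed_def)
  from normal_density_affine[OF this _ assms, of 0] have
    "distributed std_normal_distribution lborel (\<lambda>z. a * z) (normal_density 0 \<bar>a\<bar>)"
    by simp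
  then show ?thesis by (simp add: distributed_distr_eq_density[symmetric] cong: distr_cong)
qed

text \<open>This covers all real \<open>t\<close>: at 0 the law is a point mass, and for negative
  \<open>t\<close> the real square root is negative, so that the dilation is still by a real number.
  Hence no case distinction is needed for \<open>heat\<close> to be bounded.\<close>

lemma symmetric_gauss: "symmetric (gauss t)"
  unfolding symmetric_def
proof (intro conjI)
  let ?N = "std_normal_distribution"
  have meas: "(\<lambda>z. a * z) \<in> measurable ?N borel" for a :: real by simp
  show "prob_space (gauss t)"
    unfolding gauss_def by (rule prob_space.prob_space_distr[OF prob_space_std_normal meas])
  show "exp_integrable (gauss t)"
    unfolding exp_integrable_def
  proof (intro conjI allI)
    fix c
    have "integrable ?N (\<lambda>z. exp (c * \<bar>sqrt (2 * t) * z\<bar>))"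
      using exp_integrable_std_normal unfolding exp_integrable_def by (simp add: abs_mult flip: mult.assoc)
    then show "integrable (gauss t) (\<lambda>s. exp (c * \<bar>s\<bar>))"
      unfolding gauss_def by (subst integrable_distr_eq[OF meas]) auto
  qed (simp add: gauss_def)
  \<comment> \<open>Reflection is dilation by \<open>- 1\<close>, and the density of a dilated
    normal law depends only on the absolute value of the factor.\<close>
  have uminus: "distr ?N borel uminus = ?N"
    using distr_std_normal[of "- 1"] by simp
  have "distr (gauss t) borel uminus = distr ?N borel (\<lambda>z. - (sqrt (2 * t) * z))"
    unfolding gauss_def by (subst distr_distr) (auto simp: o_def)
  also have "\<dots> = distr (distr ?N borel uminus) borel (\<lambda>z. sqrt (2 * t) * z)"
    by (subst distr_distr) (auto simp: o_def)
  finally show "distr (gauss t) borel uminus = gauss t"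
    by (simp only: uminus gauss_def)
qed

text \<open>The variance is \<open>2 * t\<close> because the generator is the second derivative
  itself, not half of it.\<close>

lemma gauss_density:
  assumes "t > 0"
  shows "gauss t = density lborel (normal_density 0 (sqrt (2 * t)))"
  using distr_std_normal[of "sqrt (2 * t)"] assms by (simp add: gauss_def)

lemma conv_gauss_zero:
  assumes "continuous_on UNIV F"
  shows "conv (gauss 0) F = F"
proof
  fix x
  interpret prob_space std_normal_distribution by (rule prob_space_std_normal)
  have "conv (gauss 0) F x = (LINT z|std_normal_distribution. F (x + sqrt (2 * 0) * z))"
    unfolding conv_def gauss_def
    by (rule integral_distr)
       (auto intro!: borel_measurable_continuous_onI continuous_on_UNIV_compose[OF assms] continuous_intros)
  then show "conv (gauss 0) F x = F x" using prob_space by simp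
qed

lemma convolution_gauss:
  assumes "s > 0" "t > 0"
  shows "convolution (gauss s) (gauss t) = gauss (s + t)"
proof -
  have "convolution (gauss s) (gauss t) = density lborel (\<lambda>x. \<integral>\<^sup>+y.
      ennreal (normal_density 0 (sqrt (2 * s)) (x - y)) * ennreal (normal_density 0 (sqrt (2 * t)) y) \<partial>lborel)"
    unfolding gauss_density[OF assms(1)] gauss_density[OF assms(2)]
    by (rule convolution_density)
       (use assms in \<open>auto intro!: prob_space.finite_measure prob_space_normal_density\<close>)
  also have "\<dots> = density lborel (normal_density 0 (sqrt ((sqrt (2 * s))\<^sup>2 + (sqrt (2 * t))\<^sup>2)))"
    using conv_normal_density_zero_mean[of "sqrt (2 * s)" "sqrt (2 * t)"] assms
    by (simp add: ennreal_mult)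
  also have "\<dots> = gauss (s + t)"
    using assms by (simp add: gauss_density distrib_left)
  finally show ?thesis .
qed

lemma conv_gauss_add:
  assumes "s \<ge> 0" "t \<ge> 0" "continuous_on UNIV F" "exp_bounded F"
  shows "conv (gauss s) (conv (gauss t) F) = conv (gauss (s + t)) F"
proof -
  consider "s = 0" | "t = 0" | "s > 0" "t > 0" using assms by linarith
  then show ?thesis
  proof cases
    case 3
    then show ?thesis
      using conv_convolution[OF symmetric_gauss[THEN symmetric_exp_integrable]
          symmetric_gauss[THEN symmetric_exp_integrable] assms(3,4)]
      by (simp add: convolution_gauss)
  qed (simp_all add: conv_gauss_zero assms continuous_on_conv symmetric_gauss[THEN symmetric_exp_integrable])
qed

section \<open>The heat operators, their semigroup law and strong continuity\<close>

definition heat :: "real \<Rightarrow> C01 \<Rightarrow>\<^sub>L C01"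
  where "heat t = Blinfun (conv_C01 (gauss t))"

lemma heat_apply: "blinfun_apply (heat t) f = conv_C01 (gauss t) f"
  unfolding heat_def by (simp add: bounded_linear_Blinfun_apply bounded_linear_conv_C01 symmetric_gauss)

lemma heat_zero: "heat 0 = id_blinfun"
proof (rule blinfun_eqI)
  fix f
  show "heat 0 f = id_blinfun f"
    by (rule C01_eqI)
       (simp add: heat_apply fun_of_conv_C01[OF symmetric_gauss] conv_gauss_zero integral_extension integral_extension_unit)
qed

lemma heat_add:
  assumes "s \<ge> 0" "t \<ge> 0"
  shows "heat (s + t) = heat s o\<^sub>L heat t"
proof (rule blinfun_eqI)
  fix f
  show "heat (s + t) f = (heat s o\<^sub>L heat t) f"
    using conv_gauss_add[OF assms integral_extension_facts, of f]
    by (intro C01_eqI)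
       (simp add: heat_apply fun_of_conv_C01[OF symmetric_gauss] integral_extension_conv_C01[OF symmetric_gauss])
qed

text \<open>The integrand of the heat operator as an element of C[0,1]: \<open>heat t f\<close> is
  pointwise the standard normal average of \<open>translate (sqrt (2 * t) * z) f\<close>, so norm
  estimates for translates carry over.\<close>

definition translate :: "real \<Rightarrow> C01 \<Rightarrow> C01"
  where "translate y f = C01_of (\<lambda>x. integral_extension f (x + y))"

lemma fun_of_translate:
  assumes "x \<in> {0..1}"
  shows "fun_of (translate y f) x = integral_extension f (x + y)"
  unfolding translate_def
  by (rule fun_of_C01_of[OF _ assms])
     (intro continuous_on_UNIV_compose[OF integral_extension(2)] continuous_intros)

lemma norm_translate_le: "norm (translate y f) \<le> exp (2 * growth) * norm f * exp (growth * \<bar>y\<bar>)"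
proof (rule norm_C01_le)
  fix x :: real assume x: "x \<in> {0..1}"
  have "growth * \<bar>x + y\<bar> \<le> growth * (1 + \<bar>y\<bar>)"
    using x growth_pos by (intro mult_left_mono) auto
  then have "exp growth * exp (growth * \<bar>x + y\<bar>) * norm f
      \<le> exp growth * exp (growth * (1 + \<bar>y\<bar>)) * norm f"
    by (intro mult_right_mono mult_left_mono) auto
  then have "\<bar>integral_extension f (x + y)\<bar> \<le> exp growth * exp (growth * (1 + \<bar>y\<bar>)) * norm f"
    using abs_integral_extension_le[of f "x + y"] by linarith
  then show "\<bar>fun_of (translate y f) x\<bar> \<le> exp (2 * growth) * norm f * exp (growth * \<bar>y\<bar>)"
    using exp_add[of growth growth] by (simp add: fun_of_translate[OF x] exp_add distrib_left mult_ac)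
qed

lemma continuous_on_translate: "continuous_on UNIV (\<lambda>y. translate y f)"
  unfolding continuous_on_iff
proof (intro ballI allI impI)
  fix y e :: real assume "e > 0"
  let ?F = "integral_extension f"
  \<comment> \<open>The interval contains \<open>x + y'\<close> for all \<open>x\<close> in the unit
    interval and all \<open>y'\<close> within distance 1 of \<open>y\<close>, which is why the
    radius is later cut to \<open>min d 1\<close>.\<close>
  have "uniformly_continuous_on {y - 1..y + 2} ?F"
    by (intro compact_uniformly_continuous continuous_on_subset[OF integral_extension(2)]) auto
  then obtain d where d: "d > 0"
    "\<And>u v. u \<in> {y - 1..y + 2} \<Longrightarrow> v \<in> {y - 1..y + 2} \<Longrightarrow> dist v u < d \<Longrightarrow> dist (?F v) (?F u) < e / 2"
    unfolding uniformly_continuous_on_def using \<open>e > 0\<close> by (metis half_gt_zero)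
  show "\<exists>d>0. \<forall>y'\<in>UNIV. dist y' y < d \<longrightarrow> dist (translate y' f) (translate y f) < e"
  proof (intro exI[of _ "min d 1"] conjI ballI impI)
    fix y' assume y': "dist y' y < min d 1"
    have "norm (translate y' f - translate y f) \<le> e / 2"
    proof (rule norm_C01_le)
      fix x :: real assume x: "x \<in> {0..1}"
      have "x + y \<in> {y - 1..y + 2}" "x + y' \<in> {y - 1..y + 2}" "dist (x + y') (x + y) < d"
        using x y' by (auto simp: dist_real_def abs_less_iff)
      from d(2)[OF this] show "\<bar>fun_of (translate y' f - translate y f) x\<bar> \<le> e / 2"
        by (simp add: fun_of_translate[OF x] dist_real_def)
    qed
    with \<open>e > 0\<close> show "dist (translate y' f) (translate y f) < e" by (simp add: dist_norm)
  qed (use d in auto)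
qed

text \<open>The dependence on \<open>t\<close> moves from the measure into the integrand; limits in
  \<open>t\<close> become dominated convergence against one fixed law.\<close>

lemma fun_of_heat:
  assumes "x \<in> {0..1}"
  shows "fun_of (heat t f) x = (LINT z|std_normal_distribution. integral_extension f (x + sqrt (2 * t) * z))"
    and "integrable std_normal_distribution (\<lambda>z. integral_extension f (x + sqrt (2 * t) * z))"
proof -
  have m: "(\<lambda>s. integral_extension f (x + s)) \<in> borel_measurable borel"
    by (intro borel_measurable_continuous_onI continuous_on_UNIV_compose[OF integral_extension(2)] continuous_intros)
  have m': "(\<lambda>z. sqrt (2 * t) * z) \<in> measurable std_normal_distribution borel" by simp
  show "fun_of (heat t f) x = (LINT z|std_normal_distribution. integral_extension f (x + sqrt (2 * t) * z))"
    unfolding heat_apply fun_of_conv_C01[OF symmetric_gauss assms] conv_def unfolding gauss_def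
    by (rule integral_distr[OF m' m])
  have "integrable (gauss t) (\<lambda>s. integral_extension f (x + s))"
    by (rule integrable_shift[OF symmetric_exp_integrable[OF symmetric_gauss] integral_extension_facts])
  then show "integrable std_normal_distribution (\<lambda>z. integral_extension f (x + sqrt (2 * t) * z))"
    unfolding gauss_def by (subst (asm) integrable_distr_eq[OF m' m])
qed

lemma integrable_norm_std_normal:
  fixes V :: "real \<Rightarrow> C01"
  assumes "continuous_on UNIV V" "\<And>z. norm (V z) \<le> M * exp (c * \<bar>z\<bar>)"
  shows "integrable std_normal_distribution (\<lambda>z. norm (V z))"
  by (rule exp_integrable_bound(1)[OF exp_integrable_std_normal, of _ M c])
     (use assms in \<open>auto intro!: borel_measurable_continuous_onI continuous_intros\<close>)

text \<open>The triangle inequality for a C[0,1]-valued integral, with the integral given pointwise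
  so that none has to be formed in C[0,1].\<close>

lemma norm_le_std_normal_integral:
  fixes V :: "real \<Rightarrow> C01"
  assumes "continuous_on UNIV V" "\<And>z. norm (V z) \<le> M * exp (c * \<bar>z\<bar>)"
    and "\<And>x. x \<in> {0..1} \<Longrightarrow> integrable std_normal_distribution (\<lambda>z. fun_of (V z) x)"
    and "\<And>x. x \<in> {0..1} \<Longrightarrow> fun_of v x = (LINT z|std_normal_distribution. fun_of (V z) x)"
  shows "norm v \<le> (LINT z|std_normal_distribution. norm (V z))"
proof (rule norm_C01_le)
  fix x :: real assume x: "x \<in> {0..1}"
  show "\<bar>fun_of v x\<bar> \<le> (LINT z|std_normal_distribution. norm (V z))"
    using Bochner_Integration.integral_norm_bound_integral[OF assms(3)[OF x]
        integrable_norm_std_normal[OF assms(1,2)]] abs_fun_of_le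
    by (simp add: assms(4)[OF x])
qed

text \<open>The norms of differences of translates tend to 0 for each \<open>z\<close>. A common
  bound \<open>R\<close> on the dilation factors, inherited by their limit, supplies the exponential
  majorant.\<close>

lemma continuous_on_heat: "continuous_on UNIV (\<lambda>t. heat t f)"
proof -
  let ?N = std_normal_distribution
  have "(\<lambda>n. heat (u n) f) \<longlonglongrightarrow> heat t f" if u: "u \<longlonglongrightarrow> t" for u t
  proof -
    define a where "a n = sqrt (2 * u n)" for n
    define b where "b = sqrt (2 * t)"
    have a: "a \<longlonglongrightarrow> b" unfolding a_def b_def by (intro tendsto_intros u)
    then obtain R where R: "\<And>n. \<bar>a n\<bar> \<le> R"
      using convergent_imp_Bseq[OF convergentI[OF a]] by (auto simp: Bseq_def)
    then have Rb: "\<bar>b\<bar> \<le> R"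
      using LIMSEQ_le_const2[OF tendsto_rabs[OF a]] by blast
    define C where "C = exp (2 * growth) * norm f"
    have tr: "norm (translate (r * z) f) \<le> C * exp (growth * R * \<bar>z\<bar>)" if "\<bar>r\<bar> \<le> R" for r z
    proof -
      have "exp (growth * \<bar>r * z\<bar>) \<le> exp (growth * R * \<bar>z\<bar>)"
        using that growth_pos by (simp add: abs_mult mult_right_mono)
      then have "C * exp (growth * \<bar>r * z\<bar>) \<le> C * exp (growth * R * \<bar>z\<bar>)"
        by (intro mult_left_mono) (auto simp: C_def)
      then show ?thesis using norm_translate_le[of "r * z" f] unfolding C_def by linarith
    qed
    define V where "V n z = translate (a n * z) f - translate (b * z) f" for n z
    have V: "continuous_on UNIV (V n)" for n
      unfolding V_def
      by (intro continuous_on_diff continuous_on_UNIV_compose[OF continuous_on_translate] continuous_intros)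
    have Vb: "norm (V n z) \<le> 2 * C * exp (growth * R * \<bar>z\<bar>)" for n z
      unfolding V_def using norm_triangle_ineq4[of "translate (a n * z) f" "translate (b * z) f"]
        tr[OF R, of n z] tr[OF Rb, of z] by simp
    have "(\<lambda>n. LINT z|?N. norm (V n z)) \<longlonglongrightarrow> (LINT z|?N. 0)"
    proof (rule integral_dominated_convergence[where w = "\<lambda>z. 2 * C * exp (growth * R * \<bar>z\<bar>)"])
      show "integrable ?N (\<lambda>z. 2 * C * exp (growth * R * \<bar>z\<bar>))"
        using exp_integrable_std_normal unfolding exp_integrable_def by simp
      show "(\<lambda>z. norm (V n z)) \<in> borel_measurable ?N" for n
        using integrable_norm_std_normal[OF V Vb] by blast
      show "AE z in ?N. (\<lambda>n. norm (V n z)) \<longlonglongrightarrow> 0"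
      proof (rule AE_I2)
        fix z
        have "(\<lambda>n. translate (a n * z) f) \<longlonglongrightarrow> translate (b * z) f"
          by (intro continuous_on_tendsto_compose[OF continuous_on_translate] tendsto_intros a) auto
        then show "(\<lambda>n. norm (V n z)) \<longlonglongrightarrow> 0"
          unfolding V_def using LIM_zero tendsto_norm_zero by blast
      qed
    qed (use Vb in auto)
    then have lim: "(\<lambda>n. LINT z|?N. norm (V n z)) \<longlonglongrightarrow> 0" by simp
    have "norm (heat (u n) f - heat t f) \<le> (LINT z|?N. norm (V n z))" for n
    proof (rule norm_le_std_normal_integral[OF V Vb])
      fix x :: real assume x: "x \<in> {0..1}"
      note h = fun_of_heat[OF x, where f = f and t = "u n"] fun_of_heat[OF x, where f = f and t = t]
      show "integrable ?N (\<lambda>z. fun_of (V n z) x)"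
        using h by (simp add: V_def fun_of_translate[OF x] a_def b_def)
      show "fun_of (heat (u n) f - heat t f) x = (LINT z|?N. fun_of (V n z) x)"
        using h by (simp add: V_def fun_of_translate[OF x] a_def b_def)
    qed
    then show ?thesis
      by (intro LIM_zero_cancel[OF tendsto_norm_zero_cancel[OF tendsto_sandwich[OF _ _ tendsto_const lim]]]) auto
  qed
  then show ?thesis
    by (auto simp: continuous_on_eq_continuous_at continuous_at_sequentially o_def)
qed

lemma strongly_continuous_semigroup_heat: "strongly_continuous_semigroup heat"
  unfolding strongly_continuous_semigroup_def
  using heat_zero heat_add continuous_on_subset[OF continuous_on_heat] by blast

lemma preserves_moment_heat: "i \<le> 1 \<Longrightarrow> preserves_moment heat i"
  by (simp add: preserves_moment_def heat_apply moment_conv_C01 symmetric_gauss)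

section \<open>Semigroups determined by their generators\<close>

lemma eventually_at_right_0I:
  fixes P :: "real \<Rightarrow> bool"
  shows "(\<And>h. h > 0 \<Longrightarrow> P h) \<Longrightarrow> eventually P (at_right 0)"
  by (auto simp: eventually_at_filter)

text \<open>Generators provide right derivatives only, so the mean value theorem is replaced by a
  last-point argument: for any slope \<open>e > 0\<close>, the last point at which the increment
  from \<open>a\<close> is at most \<open>e * (s - a)\<close> can be pushed further unless it is
  \<open>b\<close>.\<close>

lemma right_derivative_zero_constant:
  fixes \<phi> :: "real \<Rightarrow> 'a::real_normed_vector"
  assumes "a \<le> b" "continuous_on {a..b} \<phi>"
    and der: "\<And>s. s \<in> {a..<b} \<Longrightarrow> ((\<lambda>h. (\<phi> (s + h) - \<phi> s) /\<^sub>R h) \<longlongrightarrow> 0) (at_right 0)"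
  shows "\<phi> b = \<phi> a"
proof -
  have "norm (\<phi> b - \<phi> a) \<le> e * (b - a)" if "e > 0" for e
  proof (rule ccontr)
    assume neg: "\<not> norm (\<phi> b - \<phi> a) \<le> e * (b - a)"
    define \<psi> where "\<psi> s = norm (\<phi> s - \<phi> a) - e * (s - a)" for s
    have "continuous_on {a..b} \<psi>"
      unfolding \<psi>_def by (intro continuous_intros assms)
    then have "closed ({a..b} \<inter> \<psi> -` {..0})"
      by (rule continuous_closed_preimage) auto
    then have "compact ({a..b} \<inter> \<psi> -` {..0})"
      using compact_Int_closed[OF compact_Icc, of _ a b] by (metis Int_assoc Int_absorb)
    moreover have "a \<in> {a..b} \<inter> \<psi> -` {..0}"
      using assms(1) by (simp add: \<psi>_def)
    ultimately obtain c where "c \<in> {a..b} \<inter> \<psi> -` {..0}" "\<forall>s\<in>{a..b} \<inter> \<psi> -` {..0}. s \<le> c"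
      using compact_attains_sup[of "{a..b} \<inter> \<psi> -` {..0}"] by blast
    \<comment> \<open>\<open>c\<close> is the last point at which the estimate holds; it exists by
      compactness.\<close>
    then have c: "c \<in> {a..b}" "\<psi> c \<le> 0"
      and max: "\<And>s. s \<in> {a..b} \<Longrightarrow> \<psi> s \<le> 0 \<Longrightarrow> s \<le> c"
      by auto
    have "c \<noteq> b" using neg c(2) by (auto simp: \<psi>_def)
    with c have cb: "c \<in> {a..<b}" by simp
    from tendstoD[OF der[OF this] that]
    have "eventually (\<lambda>h. norm ((\<phi> (c + h) - \<phi> c) /\<^sub>R h) < e) (at_right 0)" by simp
    moreover have "eventually (\<lambda>h. h < b - c) (at_right 0)"
      using eventually_at_right_real[of 0 "b - c"] cb by (auto elim: eventually_mono)
    moreover have "eventually (\<lambda>h. h > 0) (at_right (0::real))"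
      by (rule eventually_at_right_less)
    ultimately have "eventually (\<lambda>h. norm ((\<phi> (c + h) - \<phi> c) /\<^sub>R h) < e \<and> h < b - c \<and> h > 0) (at_right 0)"
      by (intro eventually_conj)
    then obtain h where h: "norm ((\<phi> (c + h) - \<phi> c) /\<^sub>R h) < e" "h < b - c" "h > 0"
      using eventually_happens'[OF trivial_limit_at_right_real] by blast
    then have "norm (\<phi> (c + h) - \<phi> c) \<le> e * h"
      by (simp add: less_imp_le flip: pos_divide_le_eq add: divide_inverse mult.commute)
    then have "\<psi> (c + h) \<le> \<psi> c"
      using norm_triangle_ineq[of "\<phi> (c + h) - \<phi> c" "\<phi> c - \<phi> a"] by (simp add: \<psi>_def algebra_simps)
    then have "c + h \<le> c"
      using c h by (intro max) auto
    with h show False by simp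
  qed
  note le = this
  have "norm (\<phi> b - \<phi> a) \<le> 0 + e" if "e > 0" for e
    using le[of "e / (b - a)"] that assms(1) by (cases "a = b") auto
  then have "norm (\<phi> b - \<phi> a) \<le> 0" by (rule field_le_epsilon)
  then show ?thesis by simp
qed

context
  fixes T :: "real \<Rightarrow> 'a::banach \<Rightarrow>\<^sub>L 'a"
  assumes T: "strongly_continuous_semigroup T"
begin

lemma semigroup_add: "s \<ge> 0 \<Longrightarrow> t \<ge> 0 \<Longrightarrow> T (s + t) f = T s (T t f)"
  using T by (simp add: strongly_continuous_semigroup_def)

lemma semigroup_commute: "s \<ge> 0 \<Longrightarrow> t \<ge> 0 \<Longrightarrow> T s (T t f) = T t (T s f)"
  by (metis add.commute semigroup_add)

lemma generator_semigroup_apply: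
  assumes "(f, g) \<in> generator T" "s \<ge> 0"
  shows "(T s f, T s g) \<in> generator T"
proof -
  have "((\<lambda>t. T s ((T t f - f) /\<^sub>R t)) \<longlongrightarrow> T s g) (at_right 0)"
    using assms(1) by (intro blinfun.tendsto tendsto_const) (simp add: generator_def)
  moreover have "eventually (\<lambda>t. T s ((T t f - f) /\<^sub>R t) = (T t (T s f) - T s f) /\<^sub>R t) (at_right 0)"
    by (rule eventually_at_right_0I)
       (simp add: blinfun.diff_right blinfun.scaleR_right semigroup_commute assms(2))
  ultimately have "((\<lambda>t. (T t (T s f) - T s f) /\<^sub>R t) \<longlongrightarrow> T s g) (at_right 0)"
    by (rule Lim_transform_eventually)
  then show ?thesis by (simp add: generator_def)
qed

lemma semigroup_has_right_derivative:
  assumes "(f, g) \<in> generator T" "s \<ge> 0"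
  shows "((\<lambda>h. (T (s + h) f - T s f) /\<^sub>R h) \<longlongrightarrow> T s g) (at_right 0)"
proof -
  have "((\<lambda>t. (T t (T s f) - T s f) /\<^sub>R t) \<longlongrightarrow> T s g) (at_right 0)"
    using generator_semigroup_apply[OF assms] by (simp add: generator_def)
  moreover have "eventually (\<lambda>t. (T t (T s f) - T s f) /\<^sub>R t = (T (s + t) f - T s f) /\<^sub>R t) (at_right 0)"
    by (rule eventually_at_right_0I) (simp add: semigroup_add semigroup_commute[of _ s] assms(2))
  ultimately show ?thesis by (rule Lim_transform_eventually)
qed

lemma generator_zero_fixed:
  assumes "(f, 0) \<in> generator T" "t \<ge> 0"
  shows "T t f = f"
proof -
  have "T t f = T 0 f"
  proof (rule right_derivative_zero_constant[OF assms(2)])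
    show "continuous_on {0..t} (\<lambda>t. T t f)"
      using T by (auto simp: strongly_continuous_semigroup_def intro: continuous_on_subset)
    show "((\<lambda>h. (T (s + h) f - T s f) /\<^sub>R h) \<longlongrightarrow> 0) (at_right 0)" if "s \<in> {0..<t}" for s
      using semigroup_has_right_derivative[OF assms(1), of s] that by (simp add: blinfun.zero_right)
  qed
  then show ?thesis using T by (simp add: strongly_continuous_semigroup_def)
qed

text \<open>The approximants are the time averages of the orbit over \<open>[0, h]\<close>. Applying
  the semigroup to an average changes only the integral near its two ends, which makes the
  difference quotient converge.\<close>

lemma generator_dense:
  "\<exists>F. (F \<longlongrightarrow> f) (at_right (0::real)) \<and> (\<forall>h>0. F h \<in> Domain (generator T))"
proof -
  define \<Phi> where "\<Phi> x = integral {0..x} (\<lambda>r. T r f)" for x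
  have cont: "continuous_on {0..b} (\<lambda>r. T r f)" for b
    using T by (auto simp: strongly_continuous_semigroup_def intro: continuous_on_subset)
  have T0: "T 0 f = f" using T by (simp add: strongly_continuous_semigroup_def)
  have int: "(\<lambda>r. T r f) integrable_on {a..b}" if "a \<ge> 0" for a b
    by (rule integrable_continuous_real[OF continuous_on_subset[OF cont[of b]]]) (use that in auto)
  have quot: "((\<lambda>s. (\<Phi> (h + s) - \<Phi> h) /\<^sub>R s) \<longlongrightarrow> T h f) (at_right 0)" if "h \<ge> 0" for h
  proof -
    have "(\<Phi> has_vector_derivative T h f) (at h within {0..h + 1})"
      unfolding \<Phi>_def by (rule integral_has_vector_derivative[OF cont]) (use that in auto)
    \<comment> \<open>Restricting to \<open>[h, h + 1]\<close> keeps only the right side of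
      \<open>h\<close>, where the filter is \<open>at_right h\<close>.\<close>
    then have "(\<Phi> has_vector_derivative T h f) (at h within {h..h + 1})"
      by (rule has_vector_derivative_within_subset) (use that in auto)
    then have "((\<lambda>y. (1 / norm (y - h)) *\<^sub>R (\<Phi> y - (\<Phi> h + (y - h) *\<^sub>R T h f))) \<longlongrightarrow> 0) (at_right h)"
      by (simp add: at_within_Icc_at_right has_vector_derivative_def has_derivative_within)
    then have "((\<lambda>s. (1 / norm s) *\<^sub>R (\<Phi> (s + h) - (\<Phi> h + s *\<^sub>R T h f))) \<longlongrightarrow> 0) (at_right 0)"
      by (simp add: filterlim_at_right_to_0[of _ _ h])
    moreover have "eventually (\<lambda>s. (1 / norm s) *\<^sub>R (\<Phi> (s + h) - (\<Phi> h + s *\<^sub>R T h f)) =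
        (\<Phi> (h + s) - \<Phi> h) /\<^sub>R s - T h f) (at_right 0)"
      by (rule eventually_at_right_0I)
         (simp add: scaleR_diff_right scaleR_add_right inverse_eq_divide add.commute[of _ h])
    ultimately have "((\<lambda>s. (\<Phi> (h + s) - \<Phi> h) /\<^sub>R s - T h f) \<longlongrightarrow> 0) (at_right 0)"
      by (rule Lim_transform_eventually)
    from LIM_zero_cancel[OF this] show ?thesis .
  qed
  show ?thesis
  proof (intro exI[of _ "\<lambda>h. \<Phi> h /\<^sub>R h"] conjI allI impI)
    show "((\<lambda>h. \<Phi> h /\<^sub>R h) \<longlongrightarrow> f) (at_right 0)"
      using quot[of 0] by (simp add: T0 \<Phi>_def)
    fix h :: real assume h: "h > 0"
    have shift: "T s (\<Phi> h) = \<Phi> (h + s) - \<Phi> s" if "s > 0" for s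
    proof -
      have "T s (\<Phi> h) = integral {0..h} (\<lambda>r. T s (T r f))"
        unfolding \<Phi>_def using integral_linear[OF int[of 0 h] blinfun.bounded_linear_right, of "T s"]
        by (simp add: o_def)
      also have "\<dots> = integral {0..h} (\<lambda>r. T (r + s) f)"
        by (intro integral_cong) (use that in \<open>simp add: semigroup_add semigroup_commute\<close>)
      also have "\<dots> = integral {s..h + s} (\<lambda>r. T r f)"
        using integral_shift_real_ivl[of s s "h + s" "\<lambda>r. T r f"] by simp
      also have "\<dots> = \<Phi> (h + s) - \<Phi> s"
        unfolding \<Phi>_def using Henstock_Kurzweil_Integration.integral_combine[of 0 s "h + s" "\<lambda>r. T r f"] int that h
        by (simp add: algebra_simps)
      finally show ?thesis .
    qed
    have "((\<lambda>s. ((\<Phi> (h + s) - \<Phi> h) /\<^sub>R s - (\<Phi> (0 + s) - \<Phi> 0) /\<^sub>R s) /\<^sub>R h) \<longlongrightarrow> (T h f - T 0 f) /\<^sub>R h) (at_right 0)"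
      by (intro tendsto_intros quot) (use h in auto)
    moreover have "eventually (\<lambda>s. ((\<Phi> (h + s) - \<Phi> h) /\<^sub>R s - (\<Phi> (0 + s) - \<Phi> 0) /\<^sub>R s) /\<^sub>R h
        = (T s (\<Phi> h /\<^sub>R h) - \<Phi> h /\<^sub>R h) /\<^sub>R s) (at_right 0)"
    proof (rule eventually_at_right_0I)
      fix s :: real assume "s > 0"
      have "\<Phi> 0 = 0" by (simp add: \<Phi>_def)
      then show "((\<Phi> (h + s) - \<Phi> h) /\<^sub>R s - (\<Phi> (0 + s) - \<Phi> 0) /\<^sub>R s) /\<^sub>R h
          = (T s (\<Phi> h /\<^sub>R h) - \<Phi> h /\<^sub>R h) /\<^sub>R s"
        by (simp add: blinfun.scaleR_right shift[OF \<open>s > 0\<close>] scaleR_diff_right mult.commute)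
    qed
    ultimately have "((\<lambda>s. (T s (\<Phi> h /\<^sub>R h) - \<Phi> h /\<^sub>R h) /\<^sub>R s) \<longlongrightarrow> (T h f - T 0 f) /\<^sub>R h) (at_right 0)"
      by (rule Lim_transform_eventually)
    then show "\<Phi> h /\<^sub>R h \<in> Domain (generator T)"
      by (auto simp: generator_def)
  qed
qed

end

text \<open>The path \<open>S (t - s) (T s f)\<close> runs from \<open>S t f\<close> to
  \<open>T t f\<close> and has right derivative 0 for \<open>f\<close> in the domain of the smaller
  generator. Density extends the equality. The bound \<open>M\<close> controls
  \<open>S (t - s)\<close> while its argument moves too; for \<open>heat\<close> it is
  explicit.\<close>

lemma generator_subset_imp_eq:
  fixes T S :: "real \<Rightarrow> 'a::banach \<Rightarrow>\<^sub>L 'a"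
  assumes T: "strongly_continuous_semigroup T" and S: "strongly_continuous_semigroup S"
    and sub: "generator T \<subseteq> generator S"
    and bdd: "\<And>s. s \<in> {0..t} \<Longrightarrow> norm (S s) \<le> M" and t: "t \<ge> 0"
  shows "T t = S t"
proof (rule blinfun_eqI)
  have contT: "continuous_on {0..} (\<lambda>t. T t f)" and contS: "continuous_on {0..} (\<lambda>t. S t f)"
    and T0: "T 0 = id_blinfun" and S0: "S 0 = id_blinfun" for f
    using T S by (simp_all add: strongly_continuous_semigroup_def)
  have bd: "norm (S s y) \<le> M * norm y" if "s \<in> {0..t}" for s y
    using norm_blinfun[of "S s" y] bdd[OF that] by (meson mult_right_mono norm_ge_zero order_trans)
  have eq: "T t f = S t f" if "f \<in> Domain (generator T)" for f
  proof -
    from that obtain g where fg: "(f, g) \<in> generator T" by blast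
    define \<phi> where "\<phi> s = S (t - s) (T s f)" for s
    have "\<phi> t = \<phi> 0"
    proof (rule right_derivative_zero_constant[OF t])
      show "continuous_on {0..t} \<phi>"
        unfolding continuous_on_def
      proof
        fix r assume r: "r \<in> {0..t}"
        have T': "((\<lambda>s. T s f) \<longlongrightarrow> T r f) (at r within {0..t})"
          using continuous_on_subset[OF contT, of "{0..t}" f] r by (auto simp: continuous_on_def)
        have "continuous_on {0..t} (\<lambda>s. S (t - s) (T r f))"
          by (rule continuous_on_compose2[OF contS]) (auto intro!: continuous_intros)
        then have S': "((\<lambda>s. S (t - s) (T r f)) \<longlongrightarrow> S (t - r) (T r f)) (at r within {0..t})"
          using r by (auto simp: continuous_on_def)
        \<comment> \<open>Operator and vector vary together: the change of the vector is bounded by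
          \<open>M\<close>, and the remaining path has a fixed vector.\<close>
        have "((\<lambda>s. S (t - s) (T s f - T r f)) \<longlongrightarrow> 0) (at r within {0..t})"
        proof (rule Lim_null_comparison)
          show "eventually (\<lambda>s. norm (S (t - s) (T s f - T r f)) \<le> M * norm (T s f - T r f)) (at r within {0..t})"
            by (auto simp: eventually_at_filter intro!: always_eventually bd)
          show "((\<lambda>s. M * norm (T s f - T r f)) \<longlongrightarrow> 0) (at r within {0..t})"
            using tendsto_mult_right_zero[OF tendsto_norm_zero[OF LIM_zero[OF T']]] .
        qed
        from tendsto_add[OF this S']
        have "((\<lambda>s. S (t - s) (T s f)) \<longlongrightarrow> S (t - r) (T r f)) (at r within {0..t})"
          by (simp add: blinfun.diff_right)
        then show "(\<phi> \<longlongrightarrow> \<phi> r) (at r within {0..t})"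
          by (simp only: \<phi>_def[abs_def])
      qed
      fix s assume s: "s \<in> {0..<t}"
      define y where "y = T s f"
      have y: "(y, T s g) \<in> generator T"
        unfolding y_def by (rule generator_semigroup_apply[OF T fg]) (use s in simp)
      with sub have y': "(y, T s g) \<in> generator S" by blast
      have "((\<lambda>h. (T h y - y) /\<^sub>R h - (S h y - y) /\<^sub>R h) \<longlongrightarrow> T s g - T s g) (at_right 0)"
        using y y' by (intro tendsto_diff) (simp_all add: generator_def)
      then have "((\<lambda>h. M * norm ((T h y - y) /\<^sub>R h - (S h y - y) /\<^sub>R h)) \<longlongrightarrow> 0) (at_right 0)"
        using tendsto_mult_right_zero tendsto_norm_zero by fastforce
      then show "((\<lambda>h. (\<phi> (s + h) - \<phi> s) /\<^sub>R h) \<longlongrightarrow> 0) (at_right 0)"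
      proof (rule Lim_null_comparison[rotated])
        have "eventually (\<lambda>h. h < t - s) (at_right 0)"
          using eventually_at_right_real[of 0 "t - s"] s by (auto elim: eventually_mono)
        moreover have "eventually (\<lambda>h. h > 0) (at_right (0::real))"
          by (rule eventually_at_right_less)
        ultimately show "eventually (\<lambda>h. norm ((\<phi> (s + h) - \<phi> s) /\<^sub>R h)
            \<le> M * norm ((T h y - y) /\<^sub>R h - (S h y - y) /\<^sub>R h)) (at_right 0)"
        proof eventually_elim
          case (elim h)
          have 1: "T (s + h) f = T h y"
            using semigroup_add[OF T, of h s f] elim s by (simp add: y_def add.commute)
          have 2: "S (t - s) y = S (t - (s + h)) (S h y)"
            using semigroup_add[OF S, of "t - (s + h)" h y] elim s by simp
          \<comment> \<open>Both semigroups start from the same \<open>y\<close>, and both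
            difference quotients converge to \<open>T s g\<close>; only their difference
            enters.\<close>
          have "(\<phi> (s + h) - \<phi> s) /\<^sub>R h = S (t - (s + h)) ((T h y - y) /\<^sub>R h - (S h y - y) /\<^sub>R h)"
            unfolding \<phi>_def 1 y_def[symmetric] 2
            by (simp add: blinfun.diff_right blinfun.scaleR_right algebra_simps)
          then show ?case using bd[of "t - (s + h)"] elim s by simp
        qed
      qed
    qed
    then show ?thesis by (simp add: \<phi>_def T0 S0)
  qed
  fix f
  obtain F :: "real \<Rightarrow> 'a" where F: "(F \<longlongrightarrow> f) (at_right 0)" "\<forall>h>0. F h \<in> Domain (generator T)"
    using generator_dense[OF T, of f] by blast
  have T': "((\<lambda>h. T t (F h)) \<longlongrightarrow> T t f) (at_right 0)" and S': "((\<lambda>h. S t (F h)) \<longlongrightarrow> S t f) (at_right 0)"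
    by (rule blinfun.tendsto[OF tendsto_const F(1)])+
  have "eventually (\<lambda>h. T t (F h) = S t (F h)) (at_right 0)"
    by (rule eventually_at_right_0I) (use eq F(2) in blast)
  from Lim_transform_eventually[OF T' this] S' show "T t f = S t f"
    by (rule tendsto_unique[OF trivial_limit_at_right_real])
qed

lemma norm_heat_le:
  assumes "s \<in> {0..t}"
  shows "norm (heat s) \<le> exp (2 * growth) * (LINT z|std_normal_distribution. exp (growth * sqrt (2 * t) * \<bar>z\<bar>))"
proof -
  have int: "integrable std_normal_distribution (\<lambda>z. exp (c * \<bar>z\<bar>))" for c
    using exp_integrable_std_normal by (simp add: exp_integrable_def)
  have "(LINT s|gauss s. exp (growth * \<bar>s\<bar>)) = (LINT z|std_normal_distribution. exp (growth * \<bar>sqrt (2 * s) * z\<bar>))"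
    unfolding gauss_def by (rule integral_distr) auto
  also have "\<dots> = (LINT z|std_normal_distribution. exp (growth * sqrt (2 * s) * \<bar>z\<bar>))"
    using assms by (simp add: abs_mult mult.assoc)
  also have "\<dots> \<le> (LINT z|std_normal_distribution. exp (growth * sqrt (2 * t) * \<bar>z\<bar>))"
  proof (rule Bochner_Integration.integral_mono[OF int int])
    fix z :: real
    have "sqrt (2 * s) \<le> sqrt (2 * t)" using assms by simp
    then have "growth * sqrt (2 * s) * \<bar>z\<bar> \<le> growth * sqrt (2 * t) * \<bar>z\<bar>"
      using growth_pos by (intro mult_right_mono mult_left_mono) linarith+
    then show "exp (growth * sqrt (2 * s) * \<bar>z\<bar>) \<le> exp (growth * sqrt (2 * t) * \<bar>z\<bar>)"
      by (simp only: exp_le_cancel_iff)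
  qed
  finally have "exp (2 * growth) * (LINT s|gauss s. exp (growth * \<bar>s\<bar>))
      \<le> exp (2 * growth) * (LINT z|std_normal_distribution. exp (growth * sqrt (2 * t) * \<bar>z\<bar>))"
    by (intro mult_left_mono) auto
  note le = this
  show ?thesis
  proof (rule norm_blinfun_bound)
    fix f
    show "norm (heat s f) \<le> exp (2 * growth) *
        (LINT z|std_normal_distribution. exp (growth * sqrt (2 * t) * \<bar>z\<bar>)) * norm f"
      using order_trans[OF norm_conv_C01_le[OF symmetric_gauss, of s f] mult_left_mono[OF le norm_ge_zero]]
      by (simp only: heat_apply mult.commute[of _ "norm f"])
  qed simp
qed

section \<open>The Weierstrass formula\<close>

lemma bounded_linear_fun_of: "bounded_linear (\<lambda>f. fun_of f x)"
  by (rule bounded_linear_intro[of _ 1]) (auto simp: abs_fun_of_le)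

lemma cosine_mp_translate: "cosine_mp t f = (translate t f + translate (- t) f) /\<^sub>R 2"
  by (rule C01_eqI) (simp add: fun_of_cosine_mp fun_of_translate)

lemma integrable_integral_even:
  fixes e :: "real \<Rightarrow> real"
  assumes "integrable lborel e" "\<And>x. e (- x) = e x"
  shows "e integrable_on {0..}" "2 * integral {0..} e = (LINT x|lborel. e x)"
proof -
  have half: "set_integrable lborel {0..} e"
    unfolding set_integrable_def using integrable_mult_indicator[OF _ assms(1), of "{0..}"] by simp
  then show "e integrable_on {0..}" by (rule set_borel_integral_eq_integral)
  define k where "k x = indicator {0..} x *\<^sub>R e x" for x
  have k: "integrable lborel k" using half by (simp add: set_integrable_def k_def[abs_def])
  have k': "integrable lborel (\<lambda>x. k (- x))" "(LINT x|lborel. k (- x)) = (LINT x|lborel. k x)"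
    using lborel_integrable_real_affine[OF k, of "- 1" 0] lborel_integral_real_affine[of "- 1" k 0] by simp_all
  have "(LINT x|lborel. e x) = (LINT x|lborel. k x + k (- x))"
  proof (rule integral_cong_AE)
    \<comment> \<open>Both halves count the point 0, so the splitting fails there and holds only
      almost everywhere.\<close>
    show "AE x in lborel. e x = k x + k (- x)"
      using AE_lborel_singleton[of "0::real"] by eventually_elim (auto simp: k_def assms(2) indicator_def)
  qed (use assms(1) k k' in auto)
  also have "\<dots> = 2 * (LINT x|lborel. k x)" using k k' by simp
  also have "(LINT x|lborel. k x) = integral {0..} e"
    using set_borel_integral_eq_integral(2)[OF half] by (simp add: set_lebesgue_integral_def k_def)
  finally show "2 * integral {0..} e = (LINT x|lborel. e x)" by simp
qed

text \<open>The symmetry of the Gaussian replaces \<open>F (x + s)\<close> by the mean of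
  \<open>F (x + s)\<close> and \<open>F (x - s)\<close>, which is the cosine family. The integrand
  is then even, so the line integral is twice the half-line integral.\<close>

lemma Weierstrass_formula:
  assumes t: "t > 0"
  shows "(\<lambda>\<tau>. exp (- \<tau>\<^sup>2 / (4 * t)) *\<^sub>R cosine_mp \<tau> f) integrable_on {0..}"
    and "heat t f = (1 / sqrt (pi * t)) *\<^sub>R integral {0..} (\<lambda>\<tau>. exp (- \<tau>\<^sup>2 / (4 * t)) *\<^sub>R cosine_mp \<tau> f)"
proof -
  define \<Phi> where "\<Phi> \<tau> = exp (- \<tau>\<^sup>2 / (4 * t)) *\<^sub>R cosine_mp \<tau> f" for \<tau>
  define k where "k = normal_density 0 (sqrt (2 * t))"
  define c where "c = sqrt (pi * t)"
  have c: "c > 0" using t by (simp add: c_def)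
  \<comment> \<open>The normal density of variance \<open>2 * t\<close> carries the factor
    \<open>1 / (2 * c)\<close>; its 2 cancels the doubling of the half-line.\<close>
  have k: "exp (- \<tau>\<^sup>2 / (4 * t)) = 2 * c * k \<tau>" for \<tau>
    using t by (simp add: k_def c_def normal_density_def real_sqrt_mult power_mult_distrib)
  have k_pos: "k \<tau> \<ge> 0" and k_even: "k (- \<tau>) = k \<tau>" for \<tau>
    by (simp_all add: k_def normal_density_def)
  have gk: "gauss t = density lborel k" using t by (simp add: k_def gauss_density)
  have [measurable]: "k \<in> borel_measurable borel" by (simp add: k_def)
  have int_k: "integrable lborel (\<lambda>\<tau>. k \<tau> * \<phi> \<tau>)" if "integrable (gauss t) \<phi>" "\<phi> \<in> borel_measurable borel" for \<phi> :: "real \<Rightarrow> real"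
    using that k_pos unfolding gk by (subst (asm) integrable_density) auto
  have cont_cos: "continuous_on UNIV (\<lambda>\<tau>. cosine_mp \<tau> f)"
    unfolding cosine_mp_translate
    by (intro continuous_intros continuous_on_UNIV_compose[OF continuous_on_translate])
  then have cont: "continuous_on UNIV \<Phi>"
    unfolding \<Phi>_def by (intro continuous_intros) (use t in auto)
  define C where "C = exp (2 * growth) * norm f"
  have cos_le: "norm (cosine_mp \<tau> f) \<le> C * exp (growth * \<bar>\<tau>\<bar>)" for \<tau>
    using norm_triangle_ineq[of "translate \<tau> f" "translate (- \<tau>) f"]
      norm_translate_le[of \<tau> f] norm_translate_le[of "- \<tau>" f]
    by (simp add: cosine_mp_translate C_def)
  have dom: "(\<lambda>\<tau>. 2 * c * (k \<tau> * (C * exp (growth * \<bar>\<tau>\<bar>)))) integrable_on {0..}"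
  proof (rule integrable_integral_even(1))
    have "integrable (gauss t) (\<lambda>\<tau>. C * exp (growth * \<bar>\<tau>\<bar>))"
      using symmetric_exp_integrable[OF symmetric_gauss[of t]] by (simp add: exp_integrable_def)
    from int_k[OF this] show "integrable lborel (\<lambda>\<tau>. 2 * c * (k \<tau> * (C * exp (growth * \<bar>\<tau>\<bar>))))"
      by simp
  qed (simp add: k_even)
  have int: "\<Phi> integrable_on {0..}"
  \<comment> \<open>Integrability in C[0,1] comes from continuity on bounded intervals and the
    scalar majorant. The value is then identified by evaluation at \<open>x\<close>, a bounded
    linear map.\<close>
  proof (rule integrable_on_all_intervals_integrable_bound[OF _ _ dom])
    fix a b :: real
    have "{0..} \<inter> {a..b} = {max 0 a..b}" by auto
    moreover have "\<Phi> integrable_on {max 0 a..b}"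
      by (intro integrable_continuous_real continuous_on_subset[OF cont] subset_UNIV)
    ultimately have "\<Phi> integrable_on ({0..} \<inter> {a..b})" by simp
    then show "(\<lambda>x. if x \<in> {0..} then \<Phi> x else 0) integrable_on cbox a b"
      by (simp only: integrable_restrict_Int cbox_interval)
    show "norm (\<Phi> \<tau>) \<le> 2 * c * (k \<tau> * (C * exp (growth * \<bar>\<tau>\<bar>)))" for \<tau>
      using mult_left_mono[OF cos_le[of \<tau>], of "2 * c * k \<tau>"] c k_pos[of \<tau>]
      unfolding \<Phi>_def k by (simp add: abs_mult mult.assoc)
  qed
  then show "(\<lambda>\<tau>. exp (- \<tau>\<^sup>2 / (4 * t)) *\<^sub>R cosine_mp \<tau> f) integrable_on {0..}"
    by (simp only: \<Phi>_def[abs_def])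
  have "heat t f = (1 / c) *\<^sub>R integral {0..} \<Phi>"
  proof (rule C01_eqI)
    fix x :: real assume x: "x \<in> {0..1}"
    let ?F = "integral_extension f"
    note sh = integrable_shift[OF symmetric_exp_integrable[OF symmetric_gauss] integral_extension_facts, of t f x]
    note mi = integral_symmetric[OF symmetric_gauss sh]
    define e where "e \<tau> = k \<tau> * ((?F (x + \<tau>) + ?F (x - \<tau>)) / 2)" for \<tau>
    have meas: "(\<lambda>\<tau>. (?F (x + \<tau>) + ?F (x - \<tau>)) / 2) \<in> borel_measurable borel"
      by (intro borel_measurable_continuous_onI continuous_intros continuous_on_UNIV_compose[OF integral_extension(2)]) auto
    have int_s: "integrable (gauss t) (\<lambda>\<tau>. (?F (x + \<tau>) + ?F (x - \<tau>)) / 2)"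
      using sh mi by simp
    have "fun_of (heat t f) x = (LINT s|gauss t. ?F (x + s))"
      by (simp add: heat_apply fun_of_conv_C01[OF symmetric_gauss x] conv_def)
    also have "\<dots> = (LINT s|gauss t. (?F (x + s) + ?F (x - s)) / 2)"
      using sh mi by simp
    also have "\<dots> = (LINT s|lborel. e s)"
      unfolding gk e_def using k_pos meas by (subst integral_density) auto
    also have "\<dots> = 2 * integral {0..} e"
      by (rule integrable_integral_even(2)[symmetric])
         (use int_k[OF int_s meas] k_even in \<open>auto simp: e_def[abs_def] add.commute\<close>)
    finally have heat: "fun_of (heat t f) x = 2 * integral {0..} e" .
    have "fun_of (integral {0..} \<Phi>) x = integral {0..} (\<lambda>\<tau>. fun_of (\<Phi> \<tau>) x)"
      using integral_linear[OF int bounded_linear_fun_of[of x]] by (simp add: o_def)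
    also have "\<dots> = integral {0..} (\<lambda>\<tau>. 2 * c * e \<tau>)"
    proof (rule integral_cong)
      fix \<tau>
      have "fun_of (\<Phi> \<tau>) x = 2 * c * k \<tau> * ((?F (x + \<tau>) + ?F (x - \<tau>)) / 2)"
        by (simp only: \<Phi>_def fun_of_cosine_mp[OF x] k fun_of_simps)
      then show "fun_of (\<Phi> \<tau>) x = 2 * c * e \<tau>" by (simp only: e_def mult.assoc)
    qed
    also have "\<dots> = 2 * c * integral {0..} e" by simp
    finally show "fun_of (heat t f) x = fun_of ((1 / c) *\<^sub>R integral {0..} \<Phi>) x"
      using heat c by (simp only: fun_of_simps) simp
  qed
  then show "heat t f = (1 / sqrt (pi * t)) *\<^sub>R integral {0..} (\<lambda>\<tau>. exp (- \<tau>\<^sup>2 / (4 * t)) *\<^sub>R cosine_mp \<tau> f)"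
    by (simp only: c_def \<Phi>_def[abs_def])
qed

section \<open>The generator of the heat semigroup\<close>

text \<open>The remainder is controlled by the oscillation of the second derivative, as no further
  derivative is available; the mean value estimate is applied to the remainder and to its
  derivative.\<close>

lemma second_order_Taylor_bound:
  fixes F F1 H :: "real \<Rightarrow> real"
  assumes F: "\<And>x. (F has_real_derivative F1 x) (at x)" and F1: "\<And>x. (F1 has_real_derivative H x) (at x)"
    and B: "\<And>r. \<bar>r\<bar> \<le> \<bar>y\<bar> \<Longrightarrow> \<bar>H (x + r) - H x\<bar> \<le> B"
  shows "\<bar>F (x + y) - F x - y * F1 x - y\<^sup>2 / 2 * H x\<bar> \<le> B * y\<^sup>2"
proof -
  define p where "p r = F1 (x + r) - F1 x - r * H x" for r
  define q where "q r = F (x + r) - F x - r * F1 x - r\<^sup>2 / 2 * H x" for r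
  have F': "((\<lambda>r. F (x + r)) has_real_derivative F1 (x + r)) (at r)"
    and F1': "((\<lambda>r. F1 (x + r)) has_real_derivative H (x + r)) (at r)" for r
    using F[of "r + x"] F1[of "r + x"] by (simp_all add: DERIV_shift add.commute[of x])
  have p': "(p has_real_derivative H (x + r) - H x) (at r)" for r
    unfolding p_def by (auto intro!: derivative_eq_intros F1')
  have q': "(q has_real_derivative p r) (at r)" for r
    unfolding q_def by (auto intro!: derivative_eq_intros F' simp: p_def)
  have "B \<ge> 0" using B[of 0] by simp
  have p_le: "\<bar>p r\<bar> \<le> B * \<bar>y\<bar>" if "\<bar>r\<bar> \<le> \<bar>y\<bar>" for r
  proof -
    have "norm (p r - p 0) \<le> B * norm (r - 0)"
      by (rule field_differentiable_bound[where S = "{-\<bar>y\<bar>..\<bar>y\<bar>}" and f' = "\<lambda>r. H (x + r) - H x"])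
         (use that B in \<open>auto intro: has_field_derivative_at_within[OF p'] simp: abs_le_iff\<close>)
    also have "\<dots> \<le> B * \<bar>y\<bar>" using that \<open>B \<ge> 0\<close> by (intro mult_left_mono) auto
    finally show ?thesis by (simp add: p_def)
  qed
  have "norm (q y - q 0) \<le> (B * \<bar>y\<bar>) * norm (y - 0)"
    by (rule field_differentiable_bound[where S = "{-\<bar>y\<bar>..\<bar>y\<bar>}" and f' = p])
       (use p_le in \<open>auto intro: has_field_derivative_at_within[OF q'] simp: abs_le_iff\<close>)
  also have "\<dots> = B * y\<^sup>2" by (simp add: power2_eq_square)
  finally show ?thesis by (simp add: q_def)
qed

lemma fun_of_C01_of_UNIV:
  assumes "continuous_on UNIV F" "x \<in> {0..1}"
  shows "fun_of (C01_of F) x = F x"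
  using assms by (intro fun_of_C01_of) (auto intro: continuous_on_subset)

lemma has_deriv_C01_of:
  assumes F: "\<And>x. (F has_real_derivative H x) (at x)" and "continuous_on UNIV H"
  shows "has_deriv_C01 (C01_of F) (C01_of H)"
  unfolding has_deriv_C01_def
proof
  fix x :: real assume x: "x \<in> {0..1}"
  have "continuous_on UNIV F" using DERIV_isCont[OF F] by (simp add: continuous_on_eq_continuous_at)
  then show "(fun_of (C01_of F) has_real_derivative fun_of (C01_of H) x) (at x within {0..1})"
    using has_field_derivative_at_within[OF F, of x "{0..1}"] x assms(2)
    by (subst has_field_derivative_cong_eventually[of _ F])
       (auto simp: fun_of_C01_of_UNIV eventually_at_filter intro!: always_eventually)
qed

lemma moment_deriv:
  assumes "has_deriv_C01 f h" "has_deriv_C01 h g"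
  shows "moment 0 g = fun_of h 1 - fun_of h 0"
    and "moment 1 g = fun_of h 1 - (fun_of f 1 - fun_of f 0)"
proof -
  have f: "(fun_of f has_real_derivative fun_of h x) (at x within {0..1})"
    and h: "(fun_of h has_real_derivative fun_of g x) (at x within {0..1})" if "x \<in> {0..1}" for x
    using assms that by (auto simp: has_deriv_C01_def)
  have "(fun_of g has_integral fun_of h 1 - fun_of h 0) {0..1}"
    by (rule fundamental_theorem_of_calculus)
       (use h in \<open>auto simp flip: has_real_derivative_iff_has_vector_derivative\<close>)
  then show "moment 0 g = fun_of h 1 - fun_of h 0"
    by (simp add: moment_def integral_unique)
  have "((\<lambda>x. x * fun_of h x - fun_of f x) has_real_derivative x * fun_of g x) (at x within {0..1})"
    if "x \<in> {0..1}" for x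
    by (rule derivative_eq_intros f h that refl | simp)+
  then have "((\<lambda>x. x * fun_of g x) has_integral (1 * fun_of h 1 - fun_of f 1) - (0 * fun_of h 0 - fun_of f 0)) {0..1}"
    by (intro fundamental_theorem_of_calculus)
       (auto simp flip: has_real_derivative_iff_has_vector_derivative)
  then show "moment 1 g = fun_of h 1 - (fun_of f 1 - fun_of f 0)"
    by (simp add: moment_def integral_unique)
qed

text \<open>Differentiating the conditions at \<open>t = 0\<close> gives
  \<open>F1 1 = F1 0 = F 1 - F 0\<close>, which by \<open>moment_deriv\<close> means that the second
  derivative has vanishing moments.\<close>

lemma moment_laplaceI:
  assumes F: "moment_extension F" and F1: "\<And>x. (F has_real_derivative F1 x) (at x)"
    and H: "\<And>x. (F1 has_real_derivative H x) (at x)" and H_cont: "continuous_on UNIV H"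
  shows "(C01_of F, C01_of H) \<in> moment_laplace"
proof -
  have cont: "continuous_on UNIV F" "continuous_on UNIV F1"
    using DERIV_isCont[OF F1] DERIV_isCont[OF H] by (simp_all add: continuous_on_eq_continuous_at)
  note d = has_deriv_C01_of[OF F1 cont(2)] has_deriv_C01_of[OF H H_cont]
  have D: "((\<lambda>t. F (1 + t) - F (1 - t)) has_real_derivative 2 * F1 1) (at 0)"
    and D0: "((\<lambda>t. F t - F (- t)) has_real_derivative 2 * F1 0) (at 0)"
    by (auto intro!: derivative_eq_intros DERIV_chain'[OF _ F1])
  have "(\<lambda>t. F (1 + t) - F (1 - t)) = (\<lambda>t. F t - F (- t))"
    "(\<lambda>t. F (1 + t) - F (1 - t)) = shift_integral F"
    using F by (auto simp: moment_extension_def)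
  then have "2 * F1 1 = 2 * F1 0" "2 * F1 1 = F (1 + 0) - F 0 + F (1 - 0) - F (- 0)"
    using DERIV_unique[OF D] D0 has_real_derivative_shift_integral[OF cont(1), of 0] by metis+
  then have "F1 1 = F1 0" "F1 1 = F 1 - F 0" by simp_all
  then show ?thesis
    using d moment_deriv[OF d] cont
    by (auto simp: moment_laplace_def second_derivative_def fun_of_C01_of_UNIV)
qed

text \<open>Rather than differentiating the recursion for \<open>f\<close>, the extension of
  \<open>g\<close> is integrated twice with the initial data of \<open>f\<close>. The result agrees
  with \<open>f\<close> on the unit interval and satisfies the conditions, so uniqueness identifies
  it as the extension of \<open>f\<close>.\<close>

lemma moment_laplace_extension:
  assumes "(f, g) \<in> moment_laplace"
  shows "\<exists>F1. (\<forall>x. (integral_extension f has_real_derivative F1 x) (at x)) \<and>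
    (\<forall>x. (F1 has_real_derivative integral_extension g x) (at x))"
proof -
  obtain f' where d: "has_deriv_C01 f f'" "has_deriv_C01 f' g" and "moment 0 g = 0" "moment 1 g = 0"
    using assms by (auto simp: moment_laplace_def second_derivative_def)
  with moment_deriv[OF d] have f': "fun_of f' 1 = fun_of f' 0" "fun_of f' 1 = fun_of f 1 - fun_of f 0"
    by simp_all
  let ?H = "integral_extension g"
  obtain G where G: "\<And>x. (G has_real_derivative ?H x) (at x)"
    using ex_antiderivative[OF integral_extension(2)] by blast
  define F1 where "F1 x = G x - G 0 + fun_of f' 0" for x
  have F1: "(F1 has_real_derivative ?H x) (at x)" for x
    unfolding F1_def by (auto intro!: derivative_eq_intros G)
  obtain K where K: "\<And>x. (K has_real_derivative F1 x) (at x)"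
    using ex_antiderivative[of F1] DERIV_isCont[OF F1] by (metis continuous_on_eq_continuous_at open_UNIV)
  define F where "F x = K x - K 0 + fun_of f 0" for x
  have F: "(F has_real_derivative F1 x) (at x)" for x
    unfolding F_def by (auto intro!: derivative_eq_intros K)
  have eq: "u x = v x" if "u 0 = v 0" "x \<in> {0..1}"
    "\<And>x. x \<in> {0..1} \<Longrightarrow> (u has_real_derivative w x) (at x within {0..1})"
    "\<And>x. x \<in> {0..1} \<Longrightarrow> (v has_real_derivative w x) (at x within {0..1})" for u v w :: "real \<Rightarrow> real" and x
  proof -
    have "((\<lambda>x. u x - v x) has_real_derivative 0) (at x within {0..1})" if "x \<in> {0..1}" for x
      using DERIV_diff[OF \<open>\<And>x. x \<in> {0..1} \<Longrightarrow> (u has_real_derivative w x) (at x within {0..1})\<close>[OF that]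
          \<open>\<And>x. x \<in> {0..1} \<Longrightarrow> (v has_real_derivative w x) (at x within {0..1})\<close>[OF that]] by simp
    then obtain k where "u x - v x = k" if "x \<in> {0..1}" for x
      using has_field_derivative_zero_constant[of "{0..1::real}" "\<lambda>x. u x - v x"] by auto
    from this[of 0] this[OF that(2)] that(1) show ?thesis by simp
  qed
  have F1_f': "F1 x = fun_of f' x" if "x \<in> {0..1}" for x
  proof (rule eq[where u = F1 and v = "fun_of f'" and w = "fun_of g", OF _ that])
    show "(F1 has_real_derivative fun_of g x) (at x within {0..1})" if "x \<in> {0..1}" for x
      using has_field_derivative_at_within[OF F1, of x "{0..1}"] by (simp only: integral_extension_unit[OF that])
  qed (use d in \<open>auto simp: F1_def has_deriv_C01_def\<close>)
  have F_f: "F x = fun_of f x" if "x \<in> {0..1}" for x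
  proof (rule eq[where u = F and v = "fun_of f" and w = "fun_of f'", OF _ that])
    show "(F has_real_derivative fun_of f' x) (at x within {0..1})" if "x \<in> {0..1}" for x
      using has_field_derivative_at_within[OF F, of x "{0..1}"] by (simp only: F1_f'[OF that])
  qed (use d in \<open>auto simp: F_def has_deriv_C01_def\<close>)
  have cont: "continuous_on UNIV F"
    using DERIV_isCont[OF F] by (simp add: continuous_on_eq_continuous_at)
  have H_odd: "?H (1 + t) - ?H (1 - t) = ?H t - ?H (- t)"
    and H_int: "?H (1 + t) - ?H (1 - t) = (F1 (1 + t) - F1 t) - (F1 (1 - t) - F1 (- t))" for t
    using moment_extension_integral_extension[of g] shift_integral_antiderivative[OF F1]
    by (auto simp: moment_extension_def)
  have const: "u t = 0" if "u 0 = 0" "v 0 = 0" "\<And>t. (u has_real_derivative v t) (at t)"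
    "\<And>t. (v has_real_derivative 0) (at t)" for u v :: "real \<Rightarrow> real" and t
  proof -
    have "v t = 0" for t using DERIV_isconst_all[of v t 0] that by simp
    then show ?thesis using DERIV_isconst_all[of u t 0] that by simp
  qed
  have "moment_extension F"
    unfolding moment_extension_def
  proof (intro conjI allI cont)
    fix t
    \<comment> \<open>The second derivative of each defect is the defect of the same condition for
      \<open>?H\<close>, hence 0. The boundary relations \<open>f'\<close> make the first derivative
      vanish at 0.\<close>
    have "F (1 + t) - F (1 - t) - (F t - F (- t)) = 0"
    proof (rule const[where u = "\<lambda>t. F (1 + t) - F (1 - t) - (F t - F (- t))"
          and v = "\<lambda>t. F1 (1 + t) + F1 (1 - t) - (F1 t + F1 (- t))"])
      show "F1 (1 + 0) + F1 (1 - 0) - (F1 0 + F1 (- 0)) = 0"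
        using f' by (simp add: F1_f')
      show "((\<lambda>t. F (1 + t) - F (1 - t) - (F t - F (- t))) has_real_derivative
          F1 (1 + t) + F1 (1 - t) - (F1 t + F1 (- t))) (at t)" for t
        by (auto intro!: derivative_eq_intros DERIV_chain'[OF _ F])
      have "((\<lambda>t. F1 (1 + t) + F1 (1 - t) - (F1 t + F1 (- t))) has_real_derivative
          ?H (1 + t) - ?H (1 - t) - (?H t - ?H (- t))) (at t)" for t
        by (auto intro!: derivative_eq_intros DERIV_chain'[OF _ F1])
      then show "((\<lambda>t. F1 (1 + t) + F1 (1 - t) - (F1 t + F1 (- t))) has_real_derivative 0) (at t)" for t
        by (simp only: H_odd diff_self)
    qed simp
    then show "F (1 + t) - F (1 - t) = F t - F (- t)" by simp
    have "F (1 + t) - F (1 - t) - shift_integral F t = 0"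
    proof (rule const[where u = "\<lambda>t. F (1 + t) - F (1 - t) - shift_integral F t"
          and v = "\<lambda>t. F1 (1 + t) + F1 (1 - t) - (F (1 + t) - F t + F (1 - t) - F (- t))"])
      show "F1 (1 + 0) + F1 (1 - 0) - (F (1 + 0) - F 0 + F (1 - 0) - F (- 0)) = 0"
        using f' by (simp add: F1_f' F_f)
      show "((\<lambda>t. F (1 + t) - F (1 - t) - shift_integral F t) has_real_derivative
          F1 (1 + t) + F1 (1 - t) - (F (1 + t) - F t + F (1 - t) - F (- t))) (at t)" for t
        by (auto intro!: derivative_eq_intros DERIV_chain'[OF _ F] has_real_derivative_shift_integral[OF cont])
      have "((\<lambda>t. F1 (1 + t) + F1 (1 - t) - (F (1 + t) - F t + F (1 - t) - F (- t))) has_real_derivative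
          ?H (1 + t) - ?H (1 - t) - ((F1 (1 + t) - F1 t) - (F1 (1 - t) - F1 (- t)))) (at t)" for t
        by (auto intro!: derivative_eq_intros DERIV_chain'[OF _ F1] DERIV_chain'[OF _ F])
      then show "((\<lambda>t. F1 (1 + t) + F1 (1 - t) - (F (1 + t) - F t + F (1 - t) - F (- t))) has_real_derivative 0) (at t)" for t
        by (simp only: H_int diff_self)
    qed (simp add: shift_integral_def)
    then show "F (1 + t) - F (1 - t) = shift_integral F t" by simp
  qed
  from integral_extension_unique[OF this F_f] have "integral_extension f = F" .
  with F F1 show ?thesis by blast
qed

lemma bounded_linear_moment: "bounded_linear (moment i)"
proof (rule bounded_linear_intro[where K = 1])
  have int: "(\<lambda>x. x ^ i * fun_of f x) integrable_on {0..1}" for f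
    by (intro integrable_continuous_real continuous_intros continuous_on_fun_of)
  show "moment i (f + g) = moment i f + moment i g" for f g
    unfolding moment_def by (subst integral_add[OF int int, symmetric]) (simp add: distrib_left)
  show "moment i (c *\<^sub>R f) = c *\<^sub>R moment i f" for c f
    unfolding moment_def by (simp add: mult.left_commute[of _ c])
  show "norm (moment i f) \<le> norm f * 1" for f
  proof -
    have "norm (moment i f) \<le> norm f * (1 - 0)"
      unfolding moment_def
    proof (rule integral_bound)
      fix x :: real assume "x \<in> {0..1}"
      then have "\<bar>x ^ i\<bar> * \<bar>fun_of f x\<bar> \<le> 1 * norm f"
        by (intro mult_mono abs_fun_of_le) (auto simp: power_le_one)
      then show "norm (x ^ i * fun_of f x) \<le> norm f" by (simp add: abs_mult)
    qed (auto intro!: continuous_intros continuous_on_fun_of)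
    then show ?thesis by simp
  qed
qed

text \<open>A preserved moment annihilates every difference quotient, hence its limit. This is
  applied to \<open>heat\<close> as well as to any competing semigroup.\<close>

lemma moment_generator_eq_zero:
  assumes "preserves_moment T i" "(f, g) \<in> generator T"
  shows "moment i g = 0"
proof -
  interpret bounded_linear "moment i" by (rule bounded_linear_moment)
  have "((\<lambda>t. moment i ((T t f - f) /\<^sub>R t)) \<longlongrightarrow> moment i g) (at_right 0)"
    using assms(2) by (intro tendsto) (simp add: generator_def)
  moreover have "eventually (\<lambda>t. moment i ((T t f - f) /\<^sub>R t) = 0) (at_right 0)"
    by (rule eventually_at_right_0I) (use assms(1) in \<open>simp add: scaleR diff preserves_moment_def\<close>)
  ultimately have "((\<lambda>t. 0) \<longlongrightarrow> moment i g) (at_right (0::real))"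
    by (rule Lim_transform_eventually)
  then show ?thesis
    using tendsto_unique[OF trivial_limit_at_right_real _ tendsto_const] by blast
qed

lemma generator_lincomb:
  assumes "(f, g) \<in> generator T" "(f', g') \<in> generator T"
  shows "(f + c *\<^sub>R f', g + c *\<^sub>R g') \<in> generator T"
proof -
  have "((\<lambda>t. (T t f - f) /\<^sub>R t + c *\<^sub>R ((T t f' - f') /\<^sub>R t)) \<longlongrightarrow> g + c *\<^sub>R g') (at_right 0)"
    using assms by (intro tendsto_intros) (simp_all add: generator_def)
  moreover have "(T t f - f) /\<^sub>R t + c *\<^sub>R ((T t f' - f') /\<^sub>R t) =
      (T t (f + c *\<^sub>R f') - (f + c *\<^sub>R f')) /\<^sub>R t" for t
    by (simp add: blinfun.add_right blinfun.scaleR_right algebra_simps)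
  ultimately show ?thesis by (simp add: generator_def)
qed

lemma has_deriv_C01_add:
  "has_deriv_C01 f g \<Longrightarrow> has_deriv_C01 f' g' \<Longrightarrow> has_deriv_C01 (f + c *\<^sub>R f') (g + c *\<^sub>R g')"
  unfolding has_deriv_C01_def
proof
  fix x :: real assume *: "x \<in> {0..1}" "\<forall>x\<in>{0..1}. (fun_of f has_real_derivative fun_of g x) (at x within {0..1})"
    "\<forall>x\<in>{0..1}. (fun_of f' has_real_derivative fun_of g' x) (at x within {0..1})"
  have "fun_of (f + c *\<^sub>R f') = (\<lambda>x. fun_of f x + c * fun_of f' x)" by auto
  with * show "(fun_of (f + c *\<^sub>R f') has_real_derivative fun_of (g + c *\<^sub>R g') x) (at x within {0..1})"
    by (auto intro!: derivative_eq_intros)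
qed

lemma moment_laplace_add:
  assumes "(f, g) \<in> moment_laplace" "(f', g') \<in> moment_laplace"
  shows "(f + c *\<^sub>R f', g + c *\<^sub>R g') \<in> moment_laplace"
  using assms has_deriv_C01_add[of _ _ _ _ c]
  unfolding moment_laplace_def second_derivative_def
  by (auto simp: bounded_linear.linear[OF bounded_linear_moment, THEN linear_add]
      bounded_linear.linear[OF bounded_linear_moment, THEN linear_scale]) blast

lemma subspace_moment_laplace: "subspace moment_laplace"
proof (rule subspaceI)
  have z: "fun_of 0 = (\<lambda>x. 0)" by auto
  then have "has_deriv_C01 0 0" by (simp add: has_deriv_C01_def)
  then show zero: "0 \<in> moment_laplace"
    by (auto simp: moment_laplace_def second_derivative_def zero_prod_def moment_def z)
  show "p + q \<in> moment_laplace" if "p \<in> moment_laplace" "q \<in> moment_laplace" for p q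
    using moment_laplace_add[of "fst p" "snd p" "fst q" "snd q" 1] that by (cases p, cases q) simp
  show "c *\<^sub>R p \<in> moment_laplace" if "p \<in> moment_laplace" for c p
    using moment_laplace_add[of 0 0 "fst p" "snd p" c] that zero by (cases p) (simp add: zero_prod_def)
qed

text \<open>The difference quotient minus \<open>g\<close> is the Gaussian average of a second-order
  Taylor remainder divided by the time. That remainder is \<open>o(y\<^sup>2)\<close> in norm near 0
  and at most \<open>y\<^sup>2\<close> times an exponential everywhere, so dominated convergence
  applies.\<close>

lemma moment_laplace_subset_generator_heat: "moment_laplace \<subseteq> generator heat"
proof clarify
  fix f g assume fg: "(f, g) \<in> moment_laplace"
  let ?N = std_normal_distribution
  let ?F = "integral_extension f" and ?H = "integral_extension g"
  obtain F1 where F: "\<And>x. (?F has_real_derivative F1 x) (at x)"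
    and F1: "\<And>x. (F1 has_real_derivative ?H x) (at x)"
    using moment_laplace_extension[OF fg] by blast
  have cont_F1: "continuous_on UNIV F1"
    using DERIV_isCont[OF F1] by (simp add: continuous_on_eq_continuous_at)
  \<comment> \<open>The Taylor remainder of the extension at all base points of the unit interval at
    once, as an element of C[0,1].\<close>
  define Q where "Q y = translate y f - f - y *\<^sub>R C01_of F1 - (y\<^sup>2 / 2) *\<^sub>R g" for y
  have Q: "fun_of (Q y) x = ?F (x + y) - ?F x - y * F1 x - y\<^sup>2 / 2 * ?H x" if "x \<in> {0..1}" for x y
    using that by (simp add: Q_def fun_of_translate fun_of_C01_of_UNIV cont_F1 integral_extension_unit)
  have Q_cont: "continuous_on UNIV Q"
    unfolding Q_def by (intro continuous_intros continuous_on_translate) auto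
  have Q_le: "norm (Q y) \<le> B * y\<^sup>2" if "\<And>r. \<bar>r\<bar> \<le> \<bar>y\<bar> \<Longrightarrow> norm (translate r g - g) \<le> B" for y B
  proof (rule norm_C01_le)
    fix x :: real assume x: "x \<in> {0..1}"
    show "\<bar>fun_of (Q y) x\<bar> \<le> B * y\<^sup>2"
      unfolding Q[OF x]
    proof (rule second_order_Taylor_bound[OF F F1])
      fix r assume "\<bar>r\<bar> \<le> \<bar>y\<bar>"
      then have "\<bar>fun_of (translate r g - g) x\<bar> \<le> B"
        using that[of r] abs_fun_of_le[of "translate r g - g" x] by linarith
      then show "\<bar>?H (x + r) - ?H x\<bar> \<le> B"
        by (simp add: fun_of_translate[OF x] integral_extension_unit[OF x])
    qed
  qed
  define D where "D = exp (2 * growth) * norm g + norm g"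
  have "D \<ge> 0" by (simp add: D_def)
  have Q_growth: "norm (Q y) \<le> D * exp (growth * \<bar>y\<bar>) * y\<^sup>2" for y
  proof (rule Q_le)
    fix r assume r: "\<bar>r\<bar> \<le> \<bar>y\<bar>"
    have "norm (translate r g - g) \<le> exp (2 * growth) * norm g * exp (growth * \<bar>r\<bar>) + norm g * 1"
      using norm_triangle_ineq4[of "translate r g" g] norm_translate_le[of r g] by linarith
    also have "\<dots> \<le> exp (2 * growth) * norm g * exp (growth * \<bar>y\<bar>) + norm g * exp (growth * \<bar>y\<bar>)"
      using growth_pos r by (intro add_mono mult_left_mono) auto
    finally show "norm (translate r g - g) \<le> D * exp (growth * \<bar>y\<bar>)"
      by (simp add: D_def distrib_right)
  qed
  have Q_small: "\<exists>d>0. \<forall>y. \<bar>y\<bar> < d \<longrightarrow> norm (Q y) \<le> e * y\<^sup>2" if "e > 0" for e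
  proof -
    have "translate 0 g = g"
      by (rule C01_eqI) (simp add: fun_of_translate integral_extension_unit)
    then obtain d where d: "d > 0" "\<And>r. \<bar>r\<bar> < d \<Longrightarrow> norm (translate r g - g) < e"
      using continuous_on_translate[of g] \<open>e > 0\<close> unfolding continuous_on_iff dist_norm
      by (metis UNIV_I diff_zero real_norm_def)
    then show ?thesis
      by (intro exI[of _ d] conjI allI impI Q_le less_imp_le[OF d(2)]) auto
  qed
  have "((\<lambda>t. (heat t f - f) /\<^sub>R t - g) \<longlongrightarrow> 0) (at_right 0)"
    unfolding tendsto_at_iff_sequentially o_def
  proof (intro allI impI)
    fix X :: "nat \<Rightarrow> real"
    assume X_pos: "\<forall>i. X i \<in> {0<..} - {0}" and X: "X \<longlonglongrightarrow> 0"
    then have pos: "X n > 0" for n by auto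
    obtain R where R: "\<And>n. \<bar>X n\<bar> \<le> R"
      using convergent_imp_Bseq[OF convergentI[OF X]] by (auto simp: Bseq_def)
    define a where "a n = sqrt (2 * X n)" for n
    have a2: "(a n)\<^sup>2 = 2 * X n" for n using pos[of n] by (simp add: a_def)
    have a_le: "\<bar>a n\<bar> \<le> sqrt (2 * R)" for n
      using R[of n] pos[of n] by (simp add: a_def)
    have a: "a \<longlonglongrightarrow> 0"
      using tendsto_real_sqrt[OF tendsto_mult_left[OF X, of 2]] by (simp add: a_def[abs_def])
    define V where "V n z = Q (a n * z) /\<^sub>R X n" for n z
    have V_cont: "continuous_on UNIV (V n)" for n
      unfolding V_def by (intro continuous_intros continuous_on_UNIV_compose[OF Q_cont])
    \<comment> \<open>\<open>sqrt (2 * R)\<close> bounds the dilations, and the additional 1 absorbs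
      \<open>z\<^sup>2 / 2 \<le> exp \<bar>z\<bar>\<close>.\<close>
    define c where "c = growth * sqrt (2 * R) + 1"
    have V_eq: "norm (V n z) = norm (Q (a n * z)) / X n" for n z
      using pos[of n] by (simp add: V_def divide_inverse mult.commute)
    have V_le: "norm (V n z) \<le> 4 * D * exp (c * \<bar>z\<bar>)" for n z
    proof -
      have "z\<^sup>2 / 2 \<le> exp \<bar>z\<bar>"
        using exp_lower_Taylor_quadratic[of "\<bar>z\<bar>"] by simp
      have "growth * \<bar>a n * z\<bar> \<le> growth * (sqrt (2 * R) * \<bar>z\<bar>)"
        unfolding abs_mult using growth_pos a_le by (intro mult_left_mono mult_right_mono) auto
      then have "exp (growth * \<bar>a n * z\<bar>) \<le> exp (growth * sqrt (2 * R) * \<bar>z\<bar>)"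
        by (simp add: mult.assoc)
      then have "D * exp (growth * \<bar>a n * z\<bar>) * (a n * z)\<^sup>2
          \<le> D * exp (growth * sqrt (2 * R) * \<bar>z\<bar>) * (a n * z)\<^sup>2"
        using \<open>D \<ge> 0\<close> by (intro mult_right_mono mult_left_mono) auto
      with Q_growth[of "a n * z"]
      have "norm (Q (a n * z)) \<le> D * exp (growth * sqrt (2 * R) * \<bar>z\<bar>) * (a n * z)\<^sup>2" by linarith
      also have "\<dots> = (4 * D * exp (growth * sqrt (2 * R) * \<bar>z\<bar>) * (z\<^sup>2 / 2)) * X n"
        by (simp add: power_mult_distrib a2)
      finally have "norm (V n z) \<le> 4 * D * exp (growth * sqrt (2 * R) * \<bar>z\<bar>) * (z\<^sup>2 / 2)"
        unfolding V_eq using pos[of n] by (simp only: pos_divide_le_eq)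
      also have "\<dots> \<le> 4 * D * exp (growth * sqrt (2 * R) * \<bar>z\<bar>) * exp \<bar>z\<bar>"
        using \<open>D \<ge> 0\<close> \<open>z\<^sup>2 / 2 \<le> exp \<bar>z\<bar>\<close> by (intro mult_left_mono) auto
      also have "\<dots> = 4 * D * exp (c * \<bar>z\<bar>)"
        by (simp add: c_def distrib_right exp_add mult.assoc)
      finally show ?thesis .
    qed
    have "(\<lambda>n. LINT z|?N. norm (V n z)) \<longlonglongrightarrow> (LINT z|?N. 0)"
    proof (rule integral_dominated_convergence[where w = "\<lambda>z. 4 * D * exp (c * \<bar>z\<bar>)"])
      show "integrable ?N (\<lambda>z. 4 * D * exp (c * \<bar>z\<bar>))"
        using exp_integrable_std_normal by (simp add: exp_integrable_def)
      show "(\<lambda>z. norm (V n z)) \<in> borel_measurable ?N" for n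
        using integrable_norm_std_normal[OF V_cont V_le] by blast
      show "AE z in ?N. (\<lambda>n. norm (V n z)) \<longlonglongrightarrow> 0"
      proof (rule AE_I2, rule LIMSEQ_I)
        fix z e :: real assume "e > 0"
        \<comment> \<open>Since \<open>(a n * z)\<^sup>2 / X n = 2 * z\<^sup>2\<close>, this
          accuracy for \<open>Q\<close> gives \<open>e\<close> for \<open>V\<close>; the summand 1
          makes the bound strict and covers \<open>z = 0\<close>.\<close>
        define e' where "e' = e / (2 * z\<^sup>2 + 1)"
        have e': "e' > 0" "e' * (2 * z\<^sup>2) < e"
        proof -
          have "2 * z\<^sup>2 + 1 > 0" by (simp add: add_nonneg_pos)
          then show "e' > 0" "e' * (2 * z\<^sup>2) < e"
            using \<open>e > 0\<close> by (simp_all add: e'_def field_simps)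
        qed
        from Q_small[OF e'(1)] obtain d where d: "d > 0" "\<And>y. \<bar>y\<bar> < d \<Longrightarrow> norm (Q y) \<le> e' * y\<^sup>2" by blast
        have "(\<lambda>n. a n * z) \<longlonglongrightarrow> 0" using tendsto_mult_left_zero[OF a] .
        from LIMSEQ_D[OF this d(1)] obtain n0 where n0: "\<And>n. n \<ge> n0 \<Longrightarrow> \<bar>a n * z\<bar> < d" by auto
        have "norm (V n z) < e" if "n \<ge> n0" for n
        proof -
          have "norm (Q (a n * z)) \<le> (e' * (2 * z\<^sup>2)) * X n"
            using d(2)[OF n0[OF that]] by (simp add: power_mult_distrib a2 mult_ac)
          then have "norm (V n z) \<le> e' * (2 * z\<^sup>2)"
            unfolding V_eq using pos[of n] by (simp only: pos_divide_le_eq)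
          with e' show ?thesis by linarith
        qed
        then show "\<exists>n0. \<forall>n\<ge>n0. norm (norm (V n z) - 0) < e" by auto
      qed
      show "AE z in ?N. norm (norm (V n z)) \<le> 4 * D * exp (c * \<bar>z\<bar>)" for n
        using V_le by simp
    qed simp
    then have lim: "(\<lambda>n. LINT z|?N. norm (V n z)) \<longlonglongrightarrow> 0" by simp
    have "norm ((heat (X n) f - f) /\<^sub>R X n - g) \<le> (LINT z|?N. norm (V n z))" for n
    proof (rule norm_le_std_normal_integral[OF V_cont V_le])
      fix x :: real assume x: "x \<in> {0..1}"
      interpret prob_space ?N by (rule prob_space_std_normal)
      note h = fun_of_heat[OF x, where f = f and t = "X n", folded a_def]
      \<comment> \<open>The linear Taylor term has mean 0; with unit variance and
        \<open>(a n)\<^sup>2 = 2 * X n\<close>, the quadratic term contributes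
        \<open>X n * ?H x\<close>.\<close>
      have z1: "integrable ?N (\<lambda>z. z)" "(LINT z|?N. z) = 0"
        using integrable_std_normal_distribution_moment[of 1] integral_std_normal_distribution_moment_odd[of 1] by simp_all
      have z2: "integrable ?N (\<lambda>z. z\<^sup>2)" "(LINT z|?N. z\<^sup>2) = 1"
        using integrable_std_normal_distribution_moment[of 2] std_normal_distribution_even_moments(1)[of 1]
        by (simp_all add: fact_2)
      have eq: "fun_of (V n z) x = (?F (x + a n * z) - ?F x - (a n * F1 x) * z - (X n * ?H x) * z\<^sup>2) / X n" for z
      proof -
        have "(a n * z)\<^sup>2 / 2 * ?H x = (X n * ?H x) * z\<^sup>2"
          by (simp add: power_mult_distrib a2)
        moreover have "fun_of (V n z) x =
            (?F (x + a n * z) - ?F x - a n * z * F1 x - (a n * z)\<^sup>2 / 2 * ?H x) / X n"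
          unfolding V_def fun_of_simps Q[OF x] by (simp only: divide_inverse mult.commute)
        ultimately show ?thesis by (simp only: mult.assoc mult.commute[of z])
      qed
      show "integrable ?N (\<lambda>z. fun_of (V n z) x)"
        unfolding eq using h z1 z2 by simp
      have "(LINT z|?N. fun_of (V n z) x) = (fun_of (heat (X n) f) x - ?F x - X n * ?H x) / X n"
        unfolding eq using h z1 z2 prob_space by simp
      then show "fun_of ((heat (X n) f - f) /\<^sub>R X n - g) x = (LINT z|?N. fun_of (V n z) x)"
        using pos[of n] integral_extension_unit[OF x, of f] integral_extension_unit[OF x, of g]
        by (simp add: diff_divide_distrib divide_inverse_commute[of _ "X n"] right_diff_distrib)
    qed
    then show "(\<lambda>n. (heat (X n) f - f) /\<^sub>R X n - g) \<longlonglongrightarrow> 0"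
      by (intro tendsto_norm_zero_cancel[OF tendsto_sandwich[OF _ _ tendsto_const lim]]) auto
  qed
  from LIM_zero_cancel[OF this] show "(f, g) \<in> generator heat"
    by (simp add: generator_def)
qed

section \<open>Interval averages, fixed points and the exact generator\<close>

lemma has_real_derivative_conv_uniform:
  assumes F: "continuous_on UNIV F" and h: "h > 0"
  shows "(conv (uniform (- h) h) F has_real_derivative (F (x + h) - F (x - h)) / (2 * h)) (at x)"
proof -
  obtain G where G: "\<And>x. (G has_real_derivative F x) (at x)"
    using ex_antiderivative[OF F] by blast
  have Gs: "((\<lambda>x. G (x + c)) has_real_derivative F (x + c)) (at x)" for x c
    using G[of "x + c"] by (simp add: DERIV_shift)
  have "conv (uniform (- h) h) F x = (G (x + h) - G (x - h)) / (2 * h)" for x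
  proof -
    have "((\<lambda>s. G (s + x)) has_real_derivative F (x + s)) (at s)" for s
      using Gs[of x s] by (simp only: add.commute)
    from integral_eq_antiderivative[OF this, of "- h" h]
    have "integral {- h..h} (\<lambda>s. F (x + s)) = G (x + h) - G (x - h)"
      using h by (simp add: add.commute)
    moreover have "continuous_on UNIV (\<lambda>s. F (x + s))"
      by (intro continuous_on_UNIV_compose[OF F] continuous_intros)
    ultimately show ?thesis
      unfolding conv_def using h by (subst integral_uniform) auto
  qed
  then have eq: "conv (uniform (- h) h) F = (\<lambda>x. (G (x + h) - G (x + - h)) / (2 * h))" by auto
  have "((\<lambda>x. (G (x + h) - G (x + - h)) / (2 * h)) has_real_derivative (F (x + h) - F (x + - h)) / (2 * h)) (at x)"
    by (intro DERIV_cdivide DERIV_diff Gs)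
  then show ?thesis by (simp add: eq)
qed

text \<open>
  Averaging twice over an interval maps into the domain of \<open>moment_laplace\<close> and commutes with the
  semigroup; on a fixed point of the semigroup the resulting second difference therefore vanishes,
  which in turn makes the averages trivial.
\<close>

lemma average_in_moment_laplace:
  fixes h :: real and f :: C01
  defines "H \<equiv> \<lambda>x. (integral_extension f (x + 2 * h) - 2 * integral_extension f x
      + integral_extension f (x - 2 * h)) / (2 * h)\<^sup>2"
  assumes h: "h > 0"
  shows "(conv_C01 (uniform (- h) h) (conv_C01 (uniform (- h) h) f), C01_of H) \<in> moment_laplace"
proof -
  let ?\<mu> = "uniform (- h) h" and ?F = "integral_extension f"
  note sym = symmetric_uniform[OF h]
  define F2 where "F2 x = (conv ?\<mu> ?F (x + h) - conv ?\<mu> ?F (x - h)) / (2 * h)" for x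
  have E1: "moment_extension (conv ?\<mu> ?F)"
    by (intro moment_extension_conv sym moment_extension_integral_extension)
  have "(C01_of (conv ?\<mu> (conv ?\<mu> ?F)), C01_of H) \<in> moment_laplace"
  proof (rule moment_laplaceI)
    show "moment_extension (conv ?\<mu> (conv ?\<mu> ?F))" by (intro moment_extension_conv sym E1)
    show "(conv ?\<mu> (conv ?\<mu> ?F) has_real_derivative F2 x) (at x)" for x
      unfolding F2_def
      by (rule has_real_derivative_conv_uniform[OF moment_extension_continuous[OF E1] h])
    have D: "((\<lambda>x. conv ?\<mu> ?F (x + c)) has_real_derivative (?F (x + c + h) - ?F (x + c - h)) / (2 * h)) (at x)" for x c
      using has_real_derivative_conv_uniform[OF integral_extension(2) h, of f "x + c"]
      by (simp only: DERIV_shift)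
    have "((\<lambda>x. (conv ?\<mu> ?F (x + h) - conv ?\<mu> ?F (x + - h)) / (2 * h)) has_real_derivative
        ((?F (x + h + h) - ?F (x + h - h)) / (2 * h) - (?F (x + - h + h) - ?F (x + - h - h)) / (2 * h)) / (2 * h)) (at x)" for x
      by (intro DERIV_cdivide DERIV_diff D)
    moreover have "((?F (x + h + h) - ?F (x + h - h)) / (2 * h) - (?F (x + - h + h) - ?F (x + - h - h)) / (2 * h)) / (2 * h) = H x" for x
    proof -
      have "x + h + h = x + 2 * h" "x + h - h = x" "x + - h + h = x" "x + - h - h = x - 2 * h" by simp_all
      then show ?thesis
        by (simp only: H_def power2_eq_square diff_divide_distrib[symmetric] divide_divide_eq_left) simp
    qed
    ultimately show "(F2 has_real_derivative H x) (at x)" for x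
      by (simp add: F2_def[abs_def])
    show "continuous_on UNIV H"
      unfolding H_def using h
      by (intro continuous_intros continuous_on_UNIV_compose[OF integral_extension(2)]) auto
  qed
  then show ?thesis
    by (simp only: conv_C01_def[of _ "conv_C01 _ _"] integral_extension_conv_C01[OF sym])
qed

text \<open>A fixed point has no known smoothness, whereas its double average has an explicit second
  derivative. That derivative vanishes for every width, so the extension satisfies the midpoint
  identity at points of the unit interval; averaging then returns \<open>w\<close>, which thereby
  becomes smooth.\<close>

lemma heat_fixed_in_moment_laplace:
  assumes fixed: "\<And>t. t \<ge> 0 \<Longrightarrow> heat t w = w"
  shows "(w, 0) \<in> moment_laplace"
proof -
  let ?W = "integral_extension w"
  define M where "M h = conv_C01 (uniform (- h) h)" for h
  have sym: "symmetric (uniform (- h) h)" if "h > 0" for h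
    using that by (rule symmetric_uniform)
  define H where "H h x = (?W (x + 2 * h) - 2 * ?W x + ?W (x - 2 * h)) / (2 * h)\<^sup>2" for h x
  have ml: "(M h (M h w), C01_of (H h)) \<in> moment_laplace" if "h > 0" for h
    using average_in_moment_laplace[OF that, of w] by (simp only: M_def H_def[abs_def])
  have H0: "C01_of (H h) = 0" if h: "h > 0" for h
  proof -
    have "heat t (M h (M h w)) = M h (M h w)" if "t \<ge> 0" for t
      using fixed[OF that] unfolding M_def heat_apply
      by (simp only: conv_C01_commute[OF symmetric_gauss sym[OF h]])
    then have "eventually (\<lambda>t. (heat t (M h (M h w)) - M h (M h w)) /\<^sub>R t = 0) (at_right 0)"
      by (intro eventually_at_right_0I) simp
    moreover have "((\<lambda>t. (heat t (M h (M h w)) - M h (M h w)) /\<^sub>R t) \<longlongrightarrow> C01_of (H h)) (at_right 0)"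
      using moment_laplace_subset_generator_heat ml[OF h] by (auto simp: generator_def)
    ultimately have "((\<lambda>t. 0) \<longlongrightarrow> C01_of (H h)) (at_right (0::real))"
      by (rule Lim_transform_eventually[rotated])
    from tendsto_unique[OF trivial_limit_at_right_real this tendsto_const] show ?thesis .
  qed
  \<comment> \<open>\<open>x\<close> stays in the unit interval, where \<open>C01_of (H h)\<close>
    carries information, but \<open>s\<close> is any real number, because the second difference is
    taken on the extension.\<close>
  have mean: "?W (x + s) + ?W (x - s) = 2 * ?W x" if x: "x \<in> {0..1}" for x s
  proof -
    have pos: "?W (x + 2 * h) + ?W (x - 2 * h) = 2 * ?W x" if "h > 0" for h
    proof -
      have "continuous_on UNIV (H h)"
        unfolding H_def using that
        by (intro continuous_intros continuous_on_UNIV_compose[OF integral_extension(2)]) auto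
      from fun_of_C01_of_UNIV[OF this x] H0[OF that] have "H h x = 0" by simp
      then show ?thesis using that by (simp add: H_def)
    qed
    consider "s > 0" | "s = 0" | "s < 0" by linarith
    then show ?thesis
      using pos[of "s / 2"] pos[of "- s / 2"] by cases auto
  qed
  have M1: "M 1 w = w"
  proof (rule C01_eqI)
    fix x :: real assume x: "x \<in> {0..1}"
    let ?\<mu> = "uniform (- 1) 1"
    have s1: "symmetric ?\<mu>" by (rule sym) simp
    interpret prob_space ?\<mu> using s1 by (simp only: symmetric_def)
    note int = integrable_shift[OF symmetric_exp_integrable[OF s1] integral_extension_facts, of w x]
    note mirror = integral_symmetric[OF s1 int]
    have "2 * (LINT s|?\<mu>. ?W (x + s)) = (LINT s|?\<mu>. ?W (x + s) + ?W (x + - s))"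
      using int mirror by (subst Bochner_Integration.integral_add) auto
    also have "\<dots> = (LINT s|?\<mu>. 2 * ?W x)"
      using mean[OF x] by simp
    also have "\<dots> = 2 * ?W x" using prob_space by simp
    finally show "fun_of (M 1 w) x = fun_of w x"
      by (simp add: M_def fun_of_conv_C01[OF s1 x] conv_def integral_extension_unit[OF x])
  qed
  \<comment> \<open>Since averaging with width 1 fixes \<open>w\<close>, the pair supplied by
    \<open>ml\<close> is \<open>(w, 0)\<close> itself.\<close>
  show ?thesis
    using ml[of 1] H0[of 1] by (simp add: M1)
qed

text \<open>The extension serves as a continuous function on the line that equals \<open>g\<close>
  on the unit interval; antiderivatives on the line avoid one-sided derivatives at the
  endpoints.\<close>

lemma second_derivative_surj: "\<exists>u. (u, g) \<in> second_derivative"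
proof -
  have cont: "continuous_on UNIV (integral_extension g)" by (rule integral_extension)
  obtain G where G: "\<And>x. (G has_real_derivative integral_extension g x) (at x)"
    using ex_antiderivative[OF cont] by blast
  have cG: "continuous_on UNIV G"
    using DERIV_isCont[OF G] by (simp add: continuous_on_eq_continuous_at)
  obtain K where K: "\<And>x. (K has_real_derivative G x) (at x)"
    using ex_antiderivative[OF cG] by blast
  have "C01_of (integral_extension g) = g"
    by (rule C01_eqI) (simp add: fun_of_C01_of_UNIV[OF cont] integral_extension_unit)
  then have "(C01_of K, g) \<in> second_derivative"
    using has_deriv_C01_of[OF K cG] has_deriv_C01_of[OF G cont] by (auto simp: second_derivative_def)
  then show ?thesis ..
qed

lemma generator_heat: "generator heat = moment_laplace"
proof
  show "generator heat \<subseteq> moment_laplace"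
  proof clarify
    fix f g assume fg: "(f, g) \<in> generator heat"
    obtain u where "(u, g) \<in> second_derivative" using second_derivative_surj by blast
    moreover have "moment i g = 0" if "i \<le> 1" for i
      by (rule moment_generator_eq_zero[OF preserves_moment_heat[OF that] fg])
    \<comment> \<open>Membership restricts only the image \<open>g\<close>, so an arbitrary second
      antiderivative \<open>u\<close> will do.\<close>
    ultimately have u: "(u, g) \<in> moment_laplace" by (simp add: moment_laplace_def)
    then have "(f + (- 1) *\<^sub>R u, g + (- 1) *\<^sub>R g) \<in> generator heat"
      using moment_laplace_subset_generator_heat by (intro generator_lincomb fg) blast
    then have "(f - u, 0) \<in> generator heat" by simp
    then have "heat t (f - u) = f - u" if "t \<ge> 0" for t
      by (rule generator_zero_fixed[OF strongly_continuous_semigroup_heat _ that])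
    then have "(f - u, 0) \<in> moment_laplace" by (rule heat_fixed_in_moment_laplace)
    from moment_laplace_add[OF u this, of 1] show "(f, g) \<in> moment_laplace" by simp
  qed
qed (rule moment_laplace_subset_generator_heat)

theorem theorem2p6:
  shows "\<exists>S :: real \<Rightarrow> C01 \<Rightarrow>\<^sub>L C01.
    strongly_continuous_semigroup S \<and> laplace_operator (generator S) \<and>
    preserves_moment S 0 \<and> preserves_moment S 1 \<and>
    (\<forall>T. strongly_continuous_semigroup T \<and> laplace_operator (generator T) \<and>
         preserves_moment T 0 \<and> preserves_moment T 1 \<longrightarrow> (\<forall>t\<ge>0. T t = S t)) \<and>
    generator S = moment_laplace \<and>
    S 0 = id_blinfun \<and>
    (\<forall>t>0. \<forall>f.
      (\<lambda>\<tau>. exp (- \<tau>\<^sup>2 / (4 * t)) *\<^sub>R cosine_mp \<tau> f) integrable_on {0..} \<and>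
      S t f = (1 / sqrt (pi * t)) *\<^sub>R
        integral {0..} (\<lambda>\<tau>. exp (- \<tau>\<^sup>2 / (4 * t)) *\<^sub>R cosine_mp \<tau> f))"
proof (rule exI[of _ heat], intro conjI allI impI)
  show "strongly_continuous_semigroup heat" by (rule strongly_continuous_semigroup_heat)
  show "laplace_operator (generator heat)"
    using subspace_moment_laplace by (auto simp: laplace_operator_def generator_heat moment_laplace_def)
  show "preserves_moment heat 0" "preserves_moment heat 1" by (simp_all add: preserves_moment_heat)
  show "generator heat = moment_laplace" by (rule generator_heat)
  show "heat 0 = id_blinfun" by (rule heat_zero)
  fix T :: "real \<Rightarrow> C01 \<Rightarrow>\<^sub>L C01" and t :: real
  assume T: "strongly_continuous_semigroup T \<and> laplace_operator (generator T) \<and>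
    preserves_moment T 0 \<and> preserves_moment T 1" and t: "t \<ge> 0"
  have "generator T \<subseteq> generator heat"
    using T moment_generator_eq_zero[of T]
    unfolding generator_heat moment_laplace_def laplace_operator_def by blast
  then show "T t = heat t"
    using T t by (intro generator_subset_imp_eq[OF _ strongly_continuous_semigroup_heat _ norm_heat_le]) auto
next
  fix t :: real and f :: C01
  assume t: "t > 0"
  show "(\<lambda>\<tau>. exp (- \<tau>\<^sup>2 / (4 * t)) *\<^sub>R cosine_mp \<tau> f) integrable_on {0..}"
    and "heat t f = (1 / sqrt (pi * t)) *\<^sub>R
        integral {0..} (\<lambda>\<tau>. exp (- \<tau>\<^sup>2 / (4 * t)) *\<^sub>R cosine_mp \<tau> f)"
    by (rule Weierstrass_formula[OF t])+
qed

end
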